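(* Consider the deterministic-design linear regression setting of the context and the maximal $p$-value criterion $M_M^n$ maximized over all subsets of $f=\{1,\ldots,M_n\}$ (i.e. $\mathcal M=2^{f}$), with $a_n\to\infty$. Assume: (1) $n^{-1}\sum_{l=1}^{n}\mathbf x_{lt}^{(n)}\mathbf x_{lt}^{(n)\prime}\to \bar{\mathbf W}$ as $n\to\infty$, where $\bar{\mathbf W}$ is a positive definite matrix; (2) $M_n/a_n\to 0$ as $n\to\infty$; (3) $\lim_{n\to\infty}M_n\ge \max_{i\in t} i$; (4) there is $\tilde\kappa>0$ such that for every $n\in\mathbf N$ the minimal eigenvalue $\tilde\kappa_n$ of $n^{-1}\mathbf X'\mathbf X$ satisfies $\tilde\kappa_n>\tilde\kappa$; (5) $a_n/n\to 0$ as $n\to\infty$. Then $P(M_M^n=t)\to 1$ as $n\to\infty$.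
   Context: Setting. For each $n$ one observes $\mathbf Y=\mathbf X\boldsymbol\beta+\boldsymbol\varepsilon$, where $\mathbf Y$ is $n\times 1$, $\mathbf X$ is a nonrandom $n\times M_n$ matrix whose entries may depend on $n$, with rows $\mathbf x_l^{(n)\prime}=(x^{(n)}_{l,1},\ldots,x^{(n)}_{l,M_n})$, $l=1,\ldots,n$, and $\boldsymbol\varepsilon\sim N(0,\sigma^2\mathbf I)$, $\sigma^2>0$. The integer sequence $(M_n)$ is nondecreasing (possibly bounded). The parameter is $\boldsymbol\beta=(\beta_1,\ldots,\beta_{M_n})'$, where the $\beta_i$ do not depend on $n$ and only finitely many are nonzero. The minimal true model is $t=\{i:\beta_i\ne 0\}$ (a fixed finite set, possibly empty); $p_t=|t|$. By convention $\max_{i\in\emptyset}i=0$. $\mathbf x_{lt}^{(n)}$ denotes the subvector of $\mathbf x_l^{(n)}$ with indices in $t$. A model is a set $j\subseteq f=\{1,\ldots,M_n\}$, $p_j=|j|$; $f$ is the full model ($p_f=M_n$), $0$ denotes the empty model ($\mathbf Y=\boldsymbol\varepsilon$). $RSS(j)$ is the sum of squared residuals of the least squares fit of $\mathbf Y$ on the columns of $\mathbf X$ with indices in $j$ (no intercept; $RSS(0)=\|\mathbf Y\|^2$). For $j\subseteq k$, $$R^n_{jk}=\frac{RSS(j)-RSS(k)}{RSS(j)}.$$ For $j\subsetneq k$, $p(R^n_{jk}|p_k,p_j)=1-F(R^n_{jk})$ where $F$ is the cumulative distribution function of the Beta distribution with shape parameters $\frac{p_k-p_j}{2}$ and $\frac{n-p_k}{2}$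 (defined for $n>p_k$). Maximal $p$-value criterion (MPVC): for a sequence $(a_n)$ of nonnegative numbers with $a_n\to\infty$, $$M_M^n=\operatorname{argmax}_{j\in\mathcal M}\, e^{-p_ja_n}\,p(R^n_{jf}|M_n,p_j),$$ with the convention $p(R^n_{ff}|M_n,M_n)=1$. If the maximizer is not unique, one with the smallest number of elements is chosen; remaining ties are broken arbitrarily. *)

theory Defs
  imports "HOL-Probability.Probability" "Jordan_Normal_Form.Spectral_Radius"
begin

text \<open>
  Indices of observations and regressors start at 1, and a design is a function
  \<open>x l i\<close> of which only the values with \<open>1 \<le> l \<le> n\<close> and \<open>1 \<le> i \<le> m\<close> matter.
\<close>

definition true_model :: "(nat \<Rightarrow> real) \<Rightarrow> nat set" where
  "true_model \<beta> = {i. 1 \<le> i \<and> \<beta> i \<noteq> 0}"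

definition response ::
  "(nat \<Rightarrow> nat \<Rightarrow> real) \<Rightarrow> nat \<Rightarrow> (nat \<Rightarrow> real) \<Rightarrow> (nat \<Rightarrow> real) \<Rightarrow> nat \<Rightarrow> real" where
  "response x m \<beta> e l = (\<Sum>i=1..m. x l i * \<beta> i) + e l"

definition sq_residuals ::
  "nat \<Rightarrow> (nat \<Rightarrow> nat \<Rightarrow> real) \<Rightarrow> (nat \<Rightarrow> real) \<Rightarrow> nat set \<Rightarrow> (nat \<Rightarrow> real) \<Rightarrow> real" where
  "sq_residuals n x y j b = (\<Sum>l=1..n. (y l - (\<Sum>i\<in>j. x l i * b i))\<^sup>2)"

text \<open>
  A least squares minimizer exists for every \<open>j\<close> (it need not be unique), so \<open>arg_min\<close> selects one;
  the residual sum does not depend on which.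
\<close>

definition RSS :: "nat \<Rightarrow> (nat \<Rightarrow> nat \<Rightarrow> real) \<Rightarrow> (nat \<Rightarrow> real) \<Rightarrow> nat set \<Rightarrow> real" where
  "RSS n x y j = sq_residuals n x y j (arg_min (sq_residuals n x y j) (\<lambda>_. True))"

definition R_coeff ::
  "nat \<Rightarrow> (nat \<Rightarrow> nat \<Rightarrow> real) \<Rightarrow> (nat \<Rightarrow> real) \<Rightarrow> nat set \<Rightarrow> nat set \<Rightarrow> real" where
  "R_coeff n x y j k = (RSS n x y j - RSS n x y k) / RSS n x y j"

definition beta_distribution :: "real \<Rightarrow> real \<Rightarrow> real measure" where
  "beta_distribution a b = density lborel
     (\<lambda>u. ennreal (indicator {0<..<1} u * (u powr (a - 1) * (1 - u) powr (b - 1) / Beta a b)))"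

text \<open>
  The \<open>p\<close>-value of the statistic value \<open>r\<close> for a model of size \<open>pj\<close> inside one of size \<open>pk\<close>.
  For nested models, equal sizes mean equal models, where the \<open>p\<close>-value is 1 by convention;
  otherwise the Beta distribution is meaningful only for \<open>pj < pk < n\<close>.
\<close>

definition p_value :: "nat \<Rightarrow> real \<Rightarrow> nat \<Rightarrow> nat \<Rightarrow> real" where
  "p_value n r pk pj =
     (if pj = pk then 1
      else 1 - cdf (beta_distribution ((real pk - real pj) / 2) ((real n - real pk) / 2)) r)"

definition mpvc_score ::
  "nat \<Rightarrow> nat \<Rightarrow> real \<Rightarrow> (nat \<Rightarrow> nat \<Rightarrow> real) \<Rightarrow> (nat \<Rightarrow> real) \<Rightarrow> nat set \<Rightarrow> real" where
  "mpvc_score n m a x y j =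
     exp (- (real (card j) * a)) * p_value n (R_coeff n x y j {1..m}) m (card j)"

text \<open>
  The possible outcomes of the maximal \<open>p\<close>-value criterion over a family \<open>\<M>\<close> of models: the
  maximizers of the score with the fewest elements. It is a predicate, not a function, because
  the ties that remain may be broken arbitrarily.
\<close>

definition is_mpvc_choice ::
  "nat set set \<Rightarrow> nat \<Rightarrow> nat \<Rightarrow> real \<Rightarrow> (nat \<Rightarrow> nat \<Rightarrow> real) \<Rightarrow> (nat \<Rightarrow> real) \<Rightarrow> nat set \<Rightarrow> bool" where
  "is_mpvc_choice \<M> n m a x y =
     is_arg_min card (is_arg_max (mpvc_score n m a x y) (\<lambda>j. j \<in> \<M>))"

definition pos_def_on :: "nat set \<Rightarrow> (nat \<Rightarrow> nat \<Rightarrow> real) \<Rightarrow> bool" where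
  "pos_def_on t W \<longleftrightarrow>
     (\<forall>i\<in>t. \<forall>k\<in>t. W i k = W k i) \<and>
     (\<forall>v. (\<exists>i\<in>t. v i \<noteq> 0) \<longrightarrow> 0 < (\<Sum>i\<in>t. \<Sum>k\<in>t. v i * W i k * v k))"

definition design_mat :: "nat \<Rightarrow> nat \<Rightarrow> (nat \<Rightarrow> nat \<Rightarrow> real) \<Rightarrow> real Matrix.mat" where
  "design_mat n m x = Matrix.mat n m (\<lambda>(l, i). x (Suc l) (Suc i))"

definition normalized_gram :: "nat \<Rightarrow> nat \<Rightarrow> (nat \<Rightarrow> nat \<Rightarrow> real) \<Rightarrow> real Matrix.mat" where
  "normalized_gram n m x =
     (1 / real n) \<cdot>\<^sub>m (transpose_mat (design_mat n m x) * design_mat n m x)"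

text \<open>
  Used for symmetric real matrices of positive dimension only; for these the set of real
  eigenvalues is the whole spectrum, finite and nonempty.
\<close>

definition min_eigenvalue :: "real Matrix.mat \<Rightarrow> real" where
  "min_eigenvalue A = Min (spectrum A)"

end

theory Submission
  imports Defs
begin

text \<open>
  Write \<open>f\<close> for the full model, \<open>m\<close> for its size, \<open>a\<close> for the penalty and \<open>e\<close> for the noise vector.
  Two quadratic forms of the noise decide everything: \<open>S = \<parallel>e\<parallel>\<^sup>2\<close>, which is close to
  \<open>n \<sigma>\<^sup>2\<close> by Chebyshev's inequality, and \<open>G\<close>, the squared norm of the least squares fit of \<open>e\<close>
  in \<open>f\<close>, whose mean is at most \<open>m \<sigma>\<^sup>2\<close>. Since \<open>m\<close> is of smaller order than \<open>a\<close>, Markov's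
  inequality gives \<open>G < \<sigma>\<^sup>2 a / 32\<close> with probability tending to one. On the event that \<open>S\<close> and \<open>G\<close>
  are of these sizes the selection is correct for every large \<open>n\<close>, for the following reasons
  (\<open>mpvc_selects_true_model\<close>).

  The true model \<open>t\<close> loses at most \<open>G\<close> in residual sum against \<open>f\<close>, so its \<open>R_coeff\<close> is at most
  \<open>a / (8 n)\<close>. This is beyond twice the mean of the Beta distribution, and there the upper tail is
  at least of order \<open>exp (- a / 4)\<close> (\<open>beta_tail_ge\<close>). Hence the \<open>p\<close>-value of \<open>t\<close> exceeds
  \<open>exp (- a / 2)\<close>, and no model of larger cardinality can win, because it pays a further factor
  \<open>exp (- a)\<close>.

  Every other model \<open>j\<close> misses some \<open>i \<in> t\<close>. Its fitted coefficients differ from \<open>\<beta>\<close> by at least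
  \<open>\<bar>\<beta> i\<bar>\<close>, and the eigenvalue bound turns this into an excess residual sum of order \<open>n\<close>, uniformly
  in \<open>j\<close> (\<open>RSS_missing_regressor\<close>). So the \<open>R_coeff\<close> of \<open>j\<close> is at least a constant \<open>c > 0\<close>, and
  the Beta tail at a constant level decays exponentially in \<open>n\<close> (\<open>beta_tail_le\<close>), faster than
  every multiple of \<open>a\<close> in the exponent. The minimal eigenvalue enters through the Rayleigh quotient
  (\<open>min_eigenvalue_le_Rayleigh\<close>).
\<close>

section \<open>Least squares by orthogonal projection\<close>

definition dot :: "nat \<Rightarrow> (nat \<Rightarrow> real) \<Rightarrow> (nat \<Rightarrow> real) \<Rightarrow> real" where
  "dot n u v = (\<Sum>l=1..n. u l * v l)"

definition fit :: "(nat \<Rightarrow> nat \<Rightarrow> real) \<Rightarrow> nat set \<Rightarrow> (nat \<Rightarrow> real) \<Rightarrow> nat \<Rightarrow> real" where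
  "fit x j b l = (\<Sum>i\<in>j. x l i * b i)"

lemma dot_commute: "dot n u v = dot n v u"
  by (simp add: dot_def mult.commute)

lemma dot_add_left: "dot n (\<lambda>l. u l + v l) w = dot n u w + dot n v w"
  by (simp add: dot_def sum.distrib algebra_simps)

lemma dot_diff_left: "dot n (\<lambda>l. u l - v l) w = dot n u w - dot n v w"
  by (simp add: dot_def sum_subtractf algebra_simps)

lemma dot_scale_left: "dot n (\<lambda>l. c * u l) w = c * dot n u w"
  by (simp add: dot_def sum_distrib_left algebra_simps)

lemma dot_add_right: "dot n w (\<lambda>l. u l + v l) = dot n w u + dot n w v"
  by (metis dot_add_left dot_commute)

lemma dot_diff_right: "dot n w (\<lambda>l. u l - v l) = dot n w u - dot n w v"
  by (metis dot_diff_left dot_commute)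

lemma dot_scale_right: "dot n w (\<lambda>l. c * u l) = c * dot n w u"
  by (metis dot_scale_left dot_commute)

lemmas dot_linear = dot_add_left dot_diff_left dot_scale_left dot_add_right dot_diff_right dot_scale_right

lemma dot_cong:
  "(\<And>l. l \<in> {1..n} \<Longrightarrow> u l = u' l) \<Longrightarrow> (\<And>l. l \<in> {1..n} \<Longrightarrow> v l = v' l) \<Longrightarrow> dot n u v = dot n u' v'"
  by (auto simp: dot_def intro!: sum.cong)

lemma dot_self_nonneg [simp]: "0 \<le> dot n u u"
  by (auto simp: dot_def intro!: sum_nonneg)

lemma dot_self_eq_0D: "dot n u u = 0 \<Longrightarrow> l \<in> {1..n} \<Longrightarrow> u l = 0"
  unfolding dot_def by (subst (asm) sum_nonneg_eq_0_iff) auto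

lemma dot_fit_right: "dot n u (fit x j b) = (\<Sum>i\<in>j. b i * dot n u (\<lambda>l. x l i))"
proof -
  have "dot n u (fit x j b) = (\<Sum>l=1..n. \<Sum>i\<in>j. b i * (u l * x l i))"
    by (simp add: dot_def fit_def sum_distrib_left algebra_simps)
  also have "\<dots> = (\<Sum>i\<in>j. \<Sum>l=1..n. b i * (u l * x l i))"
    by (rule sum.swap)
  finally show ?thesis by (simp add: dot_def sum_distrib_left)
qed

lemma dot_fit_right_eq_0:
  "(\<And>i. i \<in> j \<Longrightarrow> dot n u (\<lambda>l. x l i) = 0) \<Longrightarrow> dot n u (fit x j b) = 0"
  by (simp add: dot_fit_right)

lemma fit_diff: "fit x j (\<lambda>i. b i - c i) l = fit x j b l - fit x j c l"
  by (simp add: fit_def algebra_simps sum_subtractf)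

lemma fit_add: "fit x j (\<lambda>i. b i + c i) l = fit x j b l + fit x j c l"
  by (simp add: fit_def algebra_simps sum.distrib)

lemma fit_scale: "fit x j (\<lambda>i. k * b i) l = k * fit x j b l"
  by (simp add: fit_def algebra_simps sum_distrib_left)

lemma fit_extend:
  assumes "finite k" "j \<subseteq> k"
  shows "fit x j b = fit x k (\<lambda>i. if i \<in> j then b i else 0)"
  unfolding fit_def using assms by (intro ext sum.mono_neutral_cong_left) auto

text \<open>
  A basis of the column span, recorded through the two facts used later: its vectors
  have norm at most one, and the least squares fit of every \<open>y\<close> has squared norm
  \<open>\<Sum>k\<in>j. (dot n (q k) y)\<^sup>2\<close>. Since \<open>q\<close> does not depend on \<open>y\<close>, the expected squared norm of
  the fit of white noise is at most its variance times \<open>card j\<close>.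
\<close>

definition projection_basis ::
  "nat \<Rightarrow> (nat \<Rightarrow> nat \<Rightarrow> real) \<Rightarrow> nat set \<Rightarrow> (nat \<Rightarrow> nat \<Rightarrow> real) \<Rightarrow> bool" where
  "projection_basis n x j q \<longleftrightarrow>
     (\<forall>k\<in>j. dot n (q k) (q k) \<le> 1) \<and>
     (\<forall>y. \<exists>b. (\<forall>i\<in>j. dot n (\<lambda>l. y l - fit x j b l) (\<lambda>l. x l i) = 0) \<and>
       dot n (fit x j b) (fit x j b) = (\<Sum>k\<in>j. (dot n (q k) y)\<^sup>2))"

text \<open>
  One Gram--Schmidt step per regressor. The vectors \<open>q k\<close> constructed here are orthonormal up to
  zero vectors, which arise from regressors that depend linearly on earlier ones.
\<close>

lemma orthogonal_projection_exists:
  assumes "finite j"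
  shows "\<exists>q. projection_basis n x j q"
  using assms unfolding projection_basis_def
proof (induction j rule: finite_induct)
  case empty
  show ?case by (auto simp: fit_def dot_def)
next
  case (insert i j)
  then obtain q where q_le: "\<And>k. k \<in> j \<Longrightarrow> dot n (q k) (q k) \<le> 1"
    and q_proj: "\<And>y. \<exists>b. (\<forall>i\<in>j. dot n (\<lambda>l. y l - fit x j b l) (\<lambda>l. x l i) = 0) \<and>
       dot n (fit x j b) (fit x j b) = (\<Sum>k\<in>j. (dot n (q k) y)\<^sup>2)"
    by blast
  obtain c where c: "\<And>k. k \<in> j \<Longrightarrow> dot n (\<lambda>l. x l i - fit x j c l) (\<lambda>l. x l k) = 0"
    using q_proj[of "\<lambda>l. x l i"] by blast
  define r where "r = (\<lambda>l. x l i - fit x j c l)"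
  define \<nu> where "\<nu> = sqrt (dot n r r)"
  \<comment> \<open>For \<open>\<nu> = 0\<close> the convention \<open>inverse 0 = 0\<close> makes \<open>p\<close> the zero vector, so that one set of
    formulas covers dependent regressors as well.\<close>
  define p where "p = (\<lambda>l. inverse \<nu> * r l)"
  have \<nu>_sq: "\<nu> * \<nu> = dot n r r" by (simp add: \<nu>_def)
  have r_p: "r l = \<nu> * p l" if "l \<in> {1..n}" for l
  proof (cases "\<nu> = 0")
    case True
    then have "dot n r r = 0" using \<nu>_sq by simp
    with that True show ?thesis using dot_self_eq_0D by simp
  qed (simp add: p_def)
  have r_orth: "dot n r (\<lambda>l. x l k) = 0" if "k \<in> j" for k
    using c[OF that] by (simp add: r_def)
  have p_orth: "dot n p (\<lambda>l. x l k) = 0" if "k \<in> j" for k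
    using r_orth[OF that] by (simp add: p_def dot_scale_left)
  have p_fit: "dot n p (fit x j b) = 0" for b
    by (rule dot_fit_right_eq_0) (rule p_orth)
  have pp: "dot n p p = (if \<nu> = 0 then 0 else 1)"
    using \<nu>_sq[symmetric] by (simp add: p_def dot_scale_left dot_scale_right) (simp add: field_simps)
  have pr: "dot n p r = \<nu>"
    using \<nu>_sq[symmetric] by (simp add: p_def dot_scale_left dot_scale_right) (simp add: field_simps)
  have p0: "p = (\<lambda>l. 0)" if "\<nu> = 0" using that by (simp add: p_def)
  show ?case
  proof (intro exI[of _ "q(i := p)"] conjI ballI allI)
    fix k assume "k \<in> insert i j"
    then show "dot n ((q(i := p)) k) ((q(i := p)) k) \<le> 1"
      using q_le by (auto simp: pp)
  next
    fix y
    obtain b where b: "\<And>k. k \<in> j \<Longrightarrow> dot n (\<lambda>l. y l - fit x j b l) (\<lambda>l. x l k) = 0"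
      and b_norm: "dot n (fit x j b) (fit x j b) = (\<Sum>k\<in>j. (dot n (q k) y)\<^sup>2)"
      using q_proj[of y] by blast
    define \<alpha> where "\<alpha> = dot n p y"
    define b' where "b' = (\<lambda>k. if k = i then \<alpha> / \<nu> else b k - (\<alpha> / \<nu>) * c k)"
    have fit': "fit x (insert i j) b' l = fit x j b l + \<alpha> * p l" for l
    proof -
      have "fit x (insert i j) b' l = x l i * (\<alpha> / \<nu>) + fit x j b' l"
        using insert.hyps by (simp add: fit_def b'_def)
      also have "fit x j b' l = fit x j (\<lambda>k. b k - (\<alpha> / \<nu>) * c k) l"
        unfolding fit_def using insert.hyps by (intro sum.cong) (auto simp: b'_def)
      finally show ?thesis
        by (simp add: fit_diff fit_scale p_def r_def divide_inverse algebra_simps)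
    qed
    have s_p: "dot n (\<lambda>l. y l - fit x j b l) p = \<alpha>"
      using p_fit[of b] by (simp add: dot_linear \<alpha>_def dot_commute)
    have s_r: "dot n (\<lambda>l. y l - fit x j b l) r = \<nu> * \<alpha>"
    proof -
      have "dot n (\<lambda>l. y l - fit x j b l) r = dot n (\<lambda>l. y l - fit x j b l) (\<lambda>l. \<nu> * p l)"
        by (rule dot_cong) (auto simp: r_p)
      then show ?thesis by (simp only: dot_scale_right s_p)
    qed
    let ?s' = "\<lambda>l. y l - fit x (insert i j) b' l"
    have s': "?s' = (\<lambda>l. (y l - fit x j b l) - \<alpha> * p l)" by (simp add: fit' fun_eq_iff)
    have s'_j: "dot n ?s' (\<lambda>l. x l k) = 0" if "k \<in> j" for k
      unfolding s' dot_diff_left[of n "\<lambda>l. y l - fit x j b l"] dot_scale_left 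
      using b[OF that] p_orth[OF that] by simp
    have s'_i: "dot n ?s' (\<lambda>l. x l i) = 0"
    proof -
      have "(\<lambda>l. x l i) = (\<lambda>l. r l + fit x j c l)" by (simp add: r_def)
      then have "dot n ?s' (\<lambda>l. x l i) = dot n ?s' r + dot n ?s' (fit x j c)"
        by (metis dot_add_right)
      also have "dot n ?s' (fit x j c) = 0" by (rule dot_fit_right_eq_0) (rule s'_j)
      also have "dot n ?s' r = 0"
        unfolding s' dot_diff_left[of n "\<lambda>l. y l - fit x j b l"] dot_scale_left s_r pr by simp
      finally show ?thesis by simp
    qed
    have "dot n (fit x (insert i j) b') (fit x (insert i j) b')
        = dot n (fit x j b) (fit x j b) + \<alpha>\<^sup>2"
    proof -
      have "fit x (insert i j) b' = (\<lambda>l. fit x j b l + \<alpha> * p l)" by (simp add: fit' fun_eq_iff)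
      moreover have "\<alpha> * (\<alpha> * dot n p p) = \<alpha>\<^sup>2"
      proof (cases "\<nu> = 0")
        case True
        then have "\<alpha> = 0" using p0 by (simp add: \<alpha>_def dot_def)
        then show ?thesis by simp
      qed (simp add: pp power2_eq_square)
      ultimately show ?thesis using p_fit[of b] by (simp add: dot_linear dot_commute)
    qed
    also have "\<dots> = (\<Sum>k\<in>insert i j. (dot n ((q(i := p)) k) y)\<^sup>2)"
      using insert.hyps unfolding b_norm by (auto simp: \<alpha>_def intro!: sum.cong)
    finally show "\<exists>b. (\<forall>k\<in>insert i j. dot n (\<lambda>l. y l - fit x (insert i j) b l) (\<lambda>l. x l k) = 0) \<and>
       dot n (fit x (insert i j) b) (fit x (insert i j) b) = (\<Sum>k\<in>insert i j. (dot n ((q(i := p)) k) y)\<^sup>2)"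
      using s'_i s'_j by (intro exI[of _ b']) auto
  qed
qed

lemma sq_residuals_eq_dot:
  "sq_residuals n x y j b = dot n (\<lambda>l. y l - fit x j b l) (\<lambda>l. y l - fit x j b l)"
  by (simp add: sq_residuals_def dot_def fit_def power2_eq_square)

text \<open>
  The residual is orthogonal to every change of the fit, so by Pythagoras no other coefficients
  give a shorter residual.
\<close>

lemma RSS_normal_equations:
  assumes b: "\<And>i. i \<in> j \<Longrightarrow> dot n (\<lambda>l. y l - fit x j b l) (\<lambda>l. x l i) = 0"
  shows "RSS n x y j = dot n (\<lambda>l. y l - fit x j b l) (\<lambda>l. y l - fit x j b l)"
    and "RSS n x y j \<le> sq_residuals n x y j c"
proof -
  have ge: "sq_residuals n x y j b \<le> sq_residuals n x y j c" for c
  proof -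
    let ?s = "\<lambda>l. y l - fit x j b l" and ?d = "fit x j (\<lambda>i. b i - c i)"
    have orth: "dot n ?s ?d = 0" by (rule dot_fit_right_eq_0) (rule b)
    have "(\<lambda>l. y l - fit x j c l) = (\<lambda>l. ?s l + ?d l)" by (simp add: fit_diff)
    then have "sq_residuals n x y j c = dot n (\<lambda>l. ?s l + ?d l) (\<lambda>l. ?s l + ?d l)"
      unfolding sq_residuals_eq_dot by simp
    also have "\<dots> = dot n ?s ?s + dot n ?d ?d"
      using orth by (simp add: dot_add_left dot_add_right dot_commute[of n ?d ?s])
    finally show ?thesis unfolding sq_residuals_eq_dot by simp
  qed
  have eq: "RSS n x y j = sq_residuals n x y j b"
    unfolding RSS_def
    by (rule arg_min_equality[where k = b]) (use ge in auto)
  show "RSS n x y j = dot n (\<lambda>l. y l - fit x j b l) (\<lambda>l. y l - fit x j b l)"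
    using eq unfolding sq_residuals_eq_dot .
  show "RSS n x y j \<le> sq_residuals n x y j c"
    unfolding eq by (rule ge)
qed

lemma RSS_le:
  assumes "finite j"
  shows "RSS n x y j \<le> sq_residuals n x y j c"
proof -
  obtain b where "\<And>i. i \<in> j \<Longrightarrow> dot n (\<lambda>l. y l - fit x j b l) (\<lambda>l. x l i) = 0"
    using orthogonal_projection_exists[OF assms, of n x] unfolding projection_basis_def by blast
  then show ?thesis by (rule RSS_normal_equations)
qed

lemma RSS_mono:
  assumes "finite k" "j \<subseteq> k"
  shows "RSS n x y k \<le> RSS n x y j"
proof -
  have fj: "finite j" using assms by (rule rev_finite_subset)
  obtain b where b: "\<And>i. i \<in> j \<Longrightarrow> dot n (\<lambda>l. y l - fit x j b l) (\<lambda>l. x l i) = 0"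
    using orthogonal_projection_exists[OF fj, of n x] unfolding projection_basis_def by blast
  have "RSS n x y k \<le> sq_residuals n x y k (\<lambda>i. if i \<in> j then b i else 0)"
    by (rule RSS_le[OF assms(1)])
  also have "\<dots> = RSS n x y j"
    using RSS_normal_equations(1)[OF b] unfolding sq_residuals_eq_dot fit_extend[OF assms, symmetric] by simp
  finally show ?thesis .
qed

section \<open>The minimal eigenvalue and the Rayleigh quotient\<close>

text \<open>The first-order condition for a quadratic that is minimal at zero.\<close>

lemma linear_coeff_eq_0:
  fixes c d :: real
  assumes "\<And>s. 0 \<le> s * c + s\<^sup>2 * d"
  shows "c = 0"
proof (rule ccontr)
  assume "c \<noteq> 0"
  define k where "k = \<bar>d\<bar> + 1"
  have k: "k > 0" "d < k" by (auto simp: k_def)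
  have "(- c / k) * c + (- c / k)\<^sup>2 * d = (c\<^sup>2 / k\<^sup>2) * (d - k)"
    using k(1) by (simp add: field_simps power2_eq_square)
  also have "\<dots> < 0"
    using \<open>c \<noteq> 0\<close> k by (intro mult_pos_neg divide_pos_pos) auto
  finally show False using assms[of "- c / k"] by linarith
qed

text \<open>
  The Rayleigh quotient attains its minimum on the compact unit sphere, and the first-order
  condition at a minimizer says that it is an eigenvector for the minimal value.
\<close>

lemma min_eigenvalue_le_Rayleigh:
  fixes A :: "real Matrix.mat" and f :: "nat \<Rightarrow> real"
  assumes A: "A \<in> carrier_mat m m" and m: "0 < m"
    and sym: "\<And>i k. i < m \<Longrightarrow> k < m \<Longrightarrow> A $$ (i, k) = A $$ (k, i)"
  shows "min_eigenvalue A * (\<Sum>i<m. (f i)\<^sup>2) \<le> (\<Sum>i<m. \<Sum>k<m. f i * A $$ (i, k) * f k)"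
proof -
  define B where "B f g = (\<Sum>i<m. \<Sum>k<m. f i * A $$ (i, k) * g k)" for f g :: "nat \<Rightarrow> real"
  define N where "N f g = (\<Sum>i<m. f i * g i)" for f g :: "nat \<Rightarrow> real"
  have N_pos: "0 \<le> N f f" for f by (auto simp: N_def intro!: sum_nonneg)
  have B_add: "B (\<lambda>i. f i + s * g i) (\<lambda>i. f i + s * g i) = B f f + s * (2 * B g f) + s\<^sup>2 * B g g" for f g s
  proof -
    have "B f g = (\<Sum>i<m. \<Sum>k<m. f k * A $$ (k, i) * g i)" 
      unfolding B_def by (rule sum.swap)
    also have "\<dots> = B g f" unfolding B_def
      by (intro sum.cong refl) (use sym in auto)
    finally have sw: "B f g = B g f" .
    have "B (\<lambda>i. f i + s * g i) (\<lambda>i. f i + s * g i) = B f f + s * B f g + s * B g f + s\<^sup>2 * B g g"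
      by (simp add: B_def algebra_simps sum.distrib sum_distrib_left power2_eq_square)
    then show ?thesis using sw by (simp add: algebra_simps)
  qed
  have N_add: "N (\<lambda>i. f i + s * g i) (\<lambda>i. f i + s * g i) = N f f + s * (2 * N g f) + s\<^sup>2 * N g g" for f g s
    by (simp add: N_def algebra_simps sum.distrib sum_distrib_left power2_eq_square)
  have B_scale: "B (\<lambda>i. s * g i) (\<lambda>i. s * g i) = s\<^sup>2 * B g g" for g s
    by (simp add: B_def algebra_simps sum_distrib_left power2_eq_square)
  have N_scale: "N (\<lambda>i. s * g i) (\<lambda>i. s * g i) = s\<^sup>2 * N g g" for g s
    by (simp add: N_def algebra_simps sum_distrib_left power2_eq_square)
  \<comment> \<open>Coordinates beyond \<open>m\<close> are pinned to zero to make the unit sphere compact in the product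
    topology on functions.\<close>
  define box where "box = (PiE UNIV (\<lambda>i. if i < m then {-1..1} else {0}) :: (nat \<Rightarrow> real) set)"
  have "compactin (product_topology (\<lambda>i. euclidean) UNIV) box"
    unfolding box_def by (subst compactin_PiE) auto
  then have "compact box" by (simp add: euclidean_product_topology)
  moreover have "closed ((\<lambda>f. N f f) -` {1})"
    unfolding N_def by (intro closed_vimage continuous_intros continuous_on_product_coordinates)
  ultimately have cpt: "compact (box \<inter> (\<lambda>f. N f f) -` {1})" by (rule compact_Int_closed)
  have "(\<lambda>i. if i = 0 then 1 else 0) \<in> box \<inter> (\<lambda>f. N f f) -` {1}"
    using m by (auto simp: box_def N_def if_distrib[of "\<lambda>z. z * _"] cong: if_cong)
  then have ne: "box \<inter> (\<lambda>f. N f f) -` {1} \<noteq> {}" by blast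
  have "continuous_on (box \<inter> (\<lambda>f. N f f) -` {1}) (\<lambda>f. B f f)"
    unfolding B_def by (intro continuous_intros continuous_on_subset[OF continuous_on_product_coordinates]) auto
  from continuous_attains_inf[OF cpt ne this]
  obtain g where g: "N g g = 1" and gmin: "\<And>h. h \<in> box \<Longrightarrow> N h h = 1 \<Longrightarrow> B g g \<le> B h h" by auto
  define \<mu> where "\<mu> = B g g"
  have Rayleigh: "\<mu> * N f f \<le> B f f" for f
  proof (cases "N f f = 0")
    case True
    then have "f i = 0" if "i < m" for i
      using that unfolding N_def by (subst (asm) sum_nonneg_eq_0_iff) auto
    then have "B f f = 0" by (simp add: B_def)
    with True show ?thesis by simp
  next
    case False
    then have pos: "0 < N f f" using N_pos[of f] by linarith
    define s where "s = inverse (sqrt (N f f))"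
    define h where "h = (\<lambda>i. if i < m then s * f i else 0)"
    have s2: "s\<^sup>2 = inverse (N f f)" using pos by (simp add: s_def power_inverse)
    have Nh: "N h h = 1"
    proof -
      have "N h h = N (\<lambda>i. s * f i) (\<lambda>i. s * f i)" by (simp add: N_def h_def)
      then show ?thesis using pos by (simp add: N_scale s2)
    qed
    have "\<bar>h i\<bar> \<le> 1" if "i < m" for i
    proof -
      have "(h i)\<^sup>2 \<le> N h h" unfolding N_def power2_eq_square
        by (rule member_le_sum) (use that in auto)
      then show ?thesis using Nh by (simp add: abs_square_le_1)
    qed
    then have "h \<in> box" by (fastforce simp: box_def h_def abs_le_iff)
    then have "\<mu> \<le> B h h" using gmin Nh by (simp add: \<mu>_def)
    also have "B h h = s\<^sup>2 * B f f"
      unfolding B_scale[symmetric] by (simp add: B_def h_def)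
    finally show ?thesis using pos by (simp add: s2 field_simps)
  qed
  \<comment> \<open>\<open>B - \<mu> N\<close> is nonnegative and vanishes at \<open>g\<close>, so its derivative there vanishes in every
    direction.\<close>
  have eig: "B h g = \<mu> * N h g" for h
  proof -
    have "0 \<le> s * (2 * B h g - \<mu> * (2 * N h g)) + s\<^sup>2 * (B h h - \<mu> * N h h)" for s
      using Rayleigh[of "\<lambda>i. g i + s * h i"] g
      by (simp add: B_add N_add \<mu>_def algebra_simps)
    from linear_coeff_eq_0[OF this] show ?thesis by simp
  qed
  have "eigenvector A (Matrix.vec m g) \<mu>"
    unfolding eigenvector_def
  proof (intro conjI)
    show "Matrix.vec m g \<in> carrier_vec (dim_row A)" using A by auto
    show "Matrix.vec m g \<noteq> 0\<^sub>v (dim_row A)"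
    proof
      assume "Matrix.vec m g = 0\<^sub>v (dim_row A)"
      then have "\<And>i. i < m \<Longrightarrow> g i = 0" using A
        by (metis carrier_matD(1) index_vec index_zero_vec(1))
      then have "N g g = 0" by (simp add: N_def)
      with g show False by simp
    qed
    show "A *\<^sub>v Matrix.vec m g = \<mu> \<cdot>\<^sub>v Matrix.vec m g"
    proof (rule eq_vecI)
      fix i assume "i < dim_vec (\<mu> \<cdot>\<^sub>v Matrix.vec m g)"
      then have i: "i < m" by simp
      have "(A *\<^sub>v Matrix.vec m g) $ i = (\<Sum>k<m. A $$ (i, k) * g k)"
        using A i by (auto simp: scalar_prod_def atLeast0LessThan intro!: sum.cong)
      also have "\<dots> = B (\<lambda>k. if k = i then 1 else 0) g"
        unfolding B_def using i
        by (subst sum.swap) (simp add: if_distrib[of "\<lambda>z. z * _"] cong: if_cong)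
      also have "\<dots> = \<mu> * g i"
        unfolding eig using i by (simp add: N_def if_distrib[of "\<lambda>z. z * _"] cong: if_cong)
      finally show "(A *\<^sub>v Matrix.vec m g) $ i = (\<mu> \<cdot>\<^sub>v Matrix.vec m g) $ i"
        using i by simp
    qed (use A in auto)
  qed
  then have "\<mu> \<in> spectrum A" by (auto simp: spectrum_def eigenvalue_def)
  then have "min_eigenvalue A \<le> \<mu>"
    unfolding min_eigenvalue_def using card_finite_spectrum(1)[OF A] by (rule Min_le[rotated])
  then have "min_eigenvalue A * N f f \<le> \<mu> * N f f" by (rule mult_right_mono) (rule N_pos)
  also note Rayleigh
  finally show ?thesis by (simp add: N_def B_def power2_eq_square)
qed

lemma normalized_gram_carrier: "normalized_gram n m x \<in> carrier_mat m m"
  unfolding normalized_gram_def design_mat_def by (intro smult_carrier_mat mult_carrier_mat[of _ _ n]) auto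

lemma normalized_gram_index:
  assumes "i < m" "k < m"
  shows "normalized_gram n m x $$ (i, k) = (\<Sum>l=1..n. x l (Suc i) * x l (Suc k)) / real n"
proof -
  have "(\<Sum>l=1..n. x l (Suc i) * x l (Suc k)) = (\<Sum>l<n. x (Suc l) (Suc i) * x (Suc l) (Suc k))"
    by (rule sum.reindex_bij_witness[of _ Suc "\<lambda>l. l - 1"]) auto
  then show ?thesis
    using assms by (simp add: normalized_gram_def design_mat_def scalar_prod_def atLeast0LessThan)
qed

text \<open>
  The eigenvalue bound in the form used below: coefficients that are wrong by a fixed amount move
  the fit by a squared distance of order at least \<open>n\<close>.
\<close>

lemma fit_norm_ge:
  assumes m: "1 \<le> m" and n: "1 \<le> n"
    and ev: "\<kappa> < min_eigenvalue (normalized_gram n m x)"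
  shows "real n * \<kappa> * (\<Sum>i=1..m. (v i)\<^sup>2) \<le> dot n (fit x {1..m} v) (fit x {1..m} v)"
proof -
  have shift: "(\<Sum>i=1..m. h i) = (\<Sum>i<m. h (Suc i))" for h :: "nat \<Rightarrow> real"
    by (rule sum.reindex_bij_witness[of _ Suc "\<lambda>l. l - 1"]) auto
  define w where "w i k = (\<Sum>l=1..n. x l i * x l k)" for i k
  have gram: "normalized_gram n m x $$ (i, k) = w (Suc i) (Suc k) / real n"
    if "i < m" "k < m" for i k using that by (simp add: normalized_gram_index w_def)
  have "\<kappa> * (\<Sum>i=1..m. (v i)\<^sup>2) \<le> min_eigenvalue (normalized_gram n m x) * (\<Sum>i=1..m. (v i)\<^sup>2)"
    using ev by (intro mult_right_mono sum_nonneg) auto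
  also have "\<dots> \<le> (\<Sum>i<m. \<Sum>k<m. v (Suc i) * normalized_gram n m x $$ (i, k) * v (Suc k))"
    unfolding shift
    by (rule min_eigenvalue_le_Rayleigh[OF normalized_gram_carrier])
       (use m in \<open>auto simp: normalized_gram_index mult.commute\<close>)
  also have "\<dots> = (\<Sum>i<m. \<Sum>k<m. v (Suc i) * v (Suc k) * w (Suc i) (Suc k)) / real n"
    by (simp add: gram sum_divide_distrib mult_ac)
  also have "(\<Sum>i<m. \<Sum>k<m. v (Suc i) * v (Suc k) * w (Suc i) (Suc k))
      = (\<Sum>i=1..m. \<Sum>k=1..m. v i * v k * w i k)"
    unfolding shift ..
  also have "\<dots> = dot n (fit x {1..m} v) (fit x {1..m} v)"
    unfolding dot_fit_right unfolding dot_commute[of n "fit _ _ _"] dot_fit_right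
    by (simp add: w_def dot_def sum_distrib_left mult_ac)
  finally show ?thesis using n by (simp add: field_simps)
qed

section \<open>Tails of the Beta distribution\<close>

text \<open>
  The unnormalized Beta density. Estimates of tails are made for it, and the normalizing constant
  \<open>Beta a b\<close> is its total mass.
\<close>

definition beta_kernel :: "real \<Rightarrow> real \<Rightarrow> real \<Rightarrow> real" where
  "beta_kernel a b u = indicator {0<..<1} u * (u powr (a - 1) * (1 - u) powr (b - 1))"

lemma beta_kernel_nonneg [simp]: "0 \<le> beta_kernel a b u"
  by (simp add: beta_kernel_def)

lemma beta_kernel_measurable [measurable]: "beta_kernel a b \<in> borel_measurable borel"
  unfolding beta_kernel_def[abs_def] by measurable

lemma beta_kernel_has_integral:
  assumes "0 < a" "0 < b"
  shows "has_bochner_integral lborel (beta_kernel a b) (Beta a b)"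
proof (rule has_bochner_integral_nn_integral)
  have I: "((\<lambda>u. u powr (a - 1) * (1 - u) powr (b - 1)) has_integral Beta a b) {0<..<1}"
    using has_integral_Beta_real[OF assms] by (simp add: has_integral_Icc_iff_Ioo)
  show "0 \<le> Beta a b"
    using has_integral_nonneg[OF I] by simp
  have "(\<integral>\<^sup>+u. indicator {0<..<1} u * (u powr (a - 1) * (1 - u) powr (b - 1)) \<partial>lborel) = ennreal (Beta a b)"
    by (rule nn_integral_has_integral_lebesgue[OF _ I]) auto
  then show "(\<integral>\<^sup>+u. ennreal (beta_kernel a b u) \<partial>lborel) = ennreal (Beta a b)"
    by (simp add: beta_kernel_def)
qed auto

lemma Beta_real_pos:
  fixes a b :: real
  assumes "0 < a" "0 < b"
  shows "0 < Beta a b"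
  using assms by (simp add: Beta_def)

definition beta_upper :: "real \<Rightarrow> real \<Rightarrow> real \<Rightarrow> real" where
  "beta_upper a b r = (\<integral>u. indicator {r<..} u * beta_kernel a b u \<partial>lborel)"

lemma integrable_beta_kernel:
  assumes "0 < a" "0 < b" "S \<in> sets borel"
  shows "integrable lborel (\<lambda>u. indicator S u * beta_kernel a b u)"
  using integrable_mult_indicator[of S lborel "beta_kernel a b"]
    beta_kernel_has_integral[OF assms(1,2)] assms(3)
  by (simp add: has_bochner_integral_iff)

lemma measure_beta_distribution:
  assumes ab: "0 < a" "0 < b" and S: "S \<in> sets borel"
  shows "measure (beta_distribution a b) S = (\<integral>u. indicator S u * beta_kernel a b u \<partial>lborel) / Beta a b"
proof -
  have D: "beta_distribution a b = density lborel (\<lambda>u. ennreal (beta_kernel a b u / Beta a b))"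
    by (simp add: beta_distribution_def beta_kernel_def)
  have "emeasure (beta_distribution a b) S
      = (\<integral>\<^sup>+u. ennreal (beta_kernel a b u / Beta a b) * indicator S u \<partial>lborel)"
    unfolding D using S by (subst emeasure_density) auto
  also have "\<dots> = (\<integral>\<^sup>+u. ennreal (indicator S u * beta_kernel a b u / Beta a b) \<partial>lborel)"
    by (intro nn_integral_cong) (auto simp: indicator_def)
  also have "\<dots> = ennreal (\<integral>u. indicator S u * beta_kernel a b u / Beta a b \<partial>lborel)"
    using integrable_beta_kernel[OF ab S] Beta_real_pos[OF ab]
    by (intro nn_integral_eq_integral) auto
  finally show ?thesis
    using Beta_real_pos[OF ab] by (simp add: measure_def)
qed

lemma one_minus_cdf_beta:
  assumes ab: "0 < a" "0 < b"
  shows "1 - cdf (beta_distribution a b) r = beta_upper a b r / Beta a b"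
proof -
  have pos: "0 < Beta a b" by (rule Beta_real_pos[OF ab])
  have "beta_upper a b r + (\<integral>u. indicator {..r} u * beta_kernel a b u \<partial>lborel)
      = (\<integral>u. indicator {r<..} u * beta_kernel a b u + indicator {..r} u * beta_kernel a b u \<partial>lborel)"
    unfolding beta_upper_def
    by (rule Bochner_Integration.integral_add[symmetric]) (auto intro!: integrable_beta_kernel ab)
  also have "\<dots> = (\<integral>u. beta_kernel a b u \<partial>lborel)"
    by (intro Bochner_Integration.integral_cong) (auto simp: indicator_def)
  also have "\<dots> = Beta a b"
    using beta_kernel_has_integral[OF ab] by (simp add: has_bochner_integral_iff)
  finally show ?thesis
    using pos by (simp add: cdf_def measure_beta_distribution[OF ab] field_simps)
qed

lemma beta_upper_nonneg: "0 \<le> beta_upper a b r"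
  unfolding beta_upper_def by (intro integral_nonneg_AE) simp

lemma beta_upper_antimono:
  assumes "0 < a" "0 < b" "r \<le> s"
  shows "beta_upper a b s \<le> beta_upper a b r"
  unfolding beta_upper_def using assms(3)
  by (intro integral_mono integrable_beta_kernel assms) (auto simp: indicator_def)

lemma beta_upper_le_Beta:
  assumes ab: "0 < a" "0 < b"
  shows "beta_upper a b r \<le> Beta a b"
proof -
  have "beta_upper a b r \<le> (\<integral>u. beta_kernel a b u \<partial>lborel)"
    unfolding beta_upper_def using beta_kernel_has_integral[OF ab]
    by (intro integral_mono integrable_beta_kernel ab) (auto simp: indicator_def has_bochner_integral_iff)
  then show ?thesis
    using beta_kernel_has_integral[OF ab] by (simp add: has_bochner_integral_iff)
qed

text \<open>Only the mass of the short interval \<open>(r, 2r)\<close> is kept.\<close>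

lemma beta_upper_ge:
  assumes a: "0 < a" and b: "1 \<le> b" and r: "0 < r" "2 * r \<le> 1"
  shows "r powr a * (1 - 2 * r) powr (b - 1) / 2 \<le> beta_upper a b r"
proof -
  define C where "C = r powr a / (2 * r) * (1 - 2 * r) powr (b - 1)"
  have "C * r = (\<integral>u. C * indicator {r<..<2*r} u \<partial>lborel)"
    using r by simp
  also have "\<dots> \<le> beta_upper a b r"
    unfolding beta_upper_def
  proof (intro integral_mono integrable_beta_kernel a)
    show "integrable lborel (\<lambda>u. C * indicator {r<..<2*r} u)"
      using r by (intro integrable_mult_right integrable_real_indicator) auto
    show "0 < b" using b by simp
    fix u :: real
    show "C * indicator {r<..<2*r} u \<le> indicator {r<..} u * beta_kernel a b u"
    proof (cases "u \<in> {r<..<2*r}")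
      case True
      have "r powr a / (2 * r) \<le> u powr a / u"
        using True r a by (intro frac_le powr_mono2) auto
      also have "\<dots> = u powr (a - 1)" using True r by (simp add: powr_diff)
      finally have "r powr a / (2 * r) \<le> u powr (a - 1)" .
      moreover have "(1 - 2 * r) powr (b - 1) \<le> (1 - u) powr (b - 1)"
        using True r b by (intro powr_mono2) auto
      ultimately have "C \<le> u powr (a - 1) * (1 - u) powr (b - 1)"
        unfolding C_def using r by (intro mult_mono) auto
      then show ?thesis using True r by (simp add: beta_kernel_def)
    qed simp
  qed auto
  finally show ?thesis using r by (simp add: C_def)
qed

text \<open>
  On \<open>(c, 1)\<close> the first factor of the kernel is at most \<open>1 / u\<close> because \<open>a > 0\<close>, and the second
  is decreasing because \<open>b \<ge> 1\<close>.
\<close>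

lemma beta_upper_le:
  assumes a: "0 < a" and b: "1 \<le> b" and c: "0 < c" "c < 1"
  shows "beta_upper a b c \<le> (1 - c) powr (b - 1) / c"
proof -
  define C where "C = (1 - c) powr (b - 1) / c"
  have C: "0 \<le> C" using c by (simp add: C_def)
  have "beta_upper a b c \<le> (\<integral>u. C * indicator {c<..<1} u \<partial>lborel)"
    unfolding beta_upper_def
  proof (intro integral_mono integrable_beta_kernel a)
    show "integrable lborel (\<lambda>u. C * indicator {c<..<1} u)"
      using c by (intro integrable_mult_right integrable_real_indicator) auto
    show "0 < b" using b by simp
    fix u :: real
    show "indicator {c<..} u * beta_kernel a b u \<le> C * indicator {c<..<1} u"
    proof (cases "u \<in> {c<..<1}")
      case True
      have "u powr (a - 1) = u powr a / u" using True c by (simp add: powr_diff)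
      also have "\<dots> \<le> 1 / c"
        using True c a by (intro frac_le powr_le1) auto
      finally have "u powr (a - 1) * (1 - u) powr (b - 1) \<le> 1 / c * (1 - c) powr (b - 1)"
        using True c b by (intro mult_mono powr_mono2) auto
      then show ?thesis using True c by (simp add: beta_kernel_def C_def)
    qed (auto simp: beta_kernel_def indicator_def)
  qed auto
  also have "\<dots> = C * (1 - c)" using c by simp
  also have "\<dots> \<le> C * 1" using c C by (intro mult_left_mono) auto
  finally show ?thesis by (simp add: C_def)
qed

text \<open>
  Exponential decay in \<open>b\<close> at a fixed level \<open>c\<close>: the normalizing constant is at least the mass of
  \<open>(c / 4, c / 2)\<close>, where \<open>1 - u\<close> is larger than on the tail. The price is only exponential in
  \<open>a\<close>, which will be of smaller order than \<open>b\<close>.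
\<close>

lemma beta_tail_le:
  assumes a: "0 < a" and b: "1 \<le> b" and c: "0 < c" "c < 1"
  shows "beta_upper a b c / Beta a b \<le> 2 / c * (4 / c) powr a * ((1 - c) / (1 - c / 2)) powr (b - 1)"
proof -
  let ?L = "(c / 4) powr a * (1 - c / 2) powr (b - 1) / 2"
  have "?L \<le> beta_upper a b (c / 4)"
    using beta_upper_ge[OF a b, of "c / 4"] c by simp
  also have "\<dots> \<le> Beta a b" using a b by (intro beta_upper_le_Beta) auto
  finally have L: "?L \<le> Beta a b" .
  have "beta_upper a b c / Beta a b \<le> ((1 - c) powr (b - 1) / c) / ?L"
    using c L by (intro frac_le beta_upper_le a b) auto
  also have "\<dots> = 2 / c * (4 / c) powr a * ((1 - c) / (1 - c / 2)) powr (b - 1)"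
  proof -
    have "((1 - c) / (1 - c / 2)) powr (b - 1) = (1 - c) powr (b - 1) / (1 - c / 2) powr (b - 1)"
      using c by (intro powr_divide)
    moreover have "(4 / c) powr a = 1 / (c / 4) powr a"
      using c by (simp add: powr_divide)
    ultimately show ?thesis using c by (simp add: mult_ac)
  qed
  finally show ?thesis .
qed

text \<open>
  By Markov's inequality at least half of the mass lies below twice the mean \<open>a / (a + b)\<close>; there the
  kernel is at most \<open>u powr (a - 1)\<close>, whose integral is explicit.
\<close>

lemma Beta_le_powr:
  fixes a b :: real
  assumes a: "0 < a" and b: "1 \<le> b"
  defines "s \<equiv> 2 * a / (a + b)"
  shows "Beta a b \<le> 2 * s powr a / a"
proof -
  have b0: "0 < b" using b by simp
  have s: "0 < s" using a b by (simp add: s_def)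
  have "s * beta_upper a b s = (\<integral>u. s * (indicator {s<..} u * beta_kernel a b u) \<partial>lborel)"
    by (simp add: beta_upper_def)
  also have "\<dots> \<le> (\<integral>u. beta_kernel (a + 1) b u \<partial>lborel)"
  proof (intro integral_mono integrable_mult_right integrable_beta_kernel a b0)
    show "integrable lborel (beta_kernel (a + 1) b)"
      using beta_kernel_has_integral[of "a + 1" b] a b by (simp add: has_bochner_integral_iff)
    fix u :: real
    have "s * (u powr (a - 1) * (1 - u) powr (b - 1)) \<le> u powr a * (1 - u) powr (b - 1)"
      if "s < u" "0 < u" 
    proof -
      have "s * u powr (a - 1) \<le> u * u powr (a - 1)"
        using that by (intro mult_right_mono) auto
      also have "\<dots> = u powr a" using that by (simp add: powr_diff)
      finally show ?thesis by (simp add: mult.assoc[symmetric] mult_right_mono)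
    qed
    then show "s * (indicator {s<..} u * beta_kernel a b u) \<le> beta_kernel (a + 1) b u"
      by (auto simp: beta_kernel_def indicator_def)
  qed auto
  also have "\<dots> = Beta (a + 1) b"
    using beta_kernel_has_integral[of "a + 1" b] a b by (simp add: has_bochner_integral_iff)
  also have "\<dots> = (s / 2) * Beta a b"
  proof -
    have "(a + b) * Beta (a + 1) b = a * Beta a b"
      using a b by (intro Beta_plus1_left) (auto elim!: nonpos_Ints_cases)
    then show ?thesis using a b by (simp add: s_def field_simps)
  qed
  finally have upper: "beta_upper a b s \<le> Beta a b / 2" using s by (simp add: field_simps)
  have powr_int: "has_bochner_integral lborel (\<lambda>u. indicator {0..s} u * u powr (a - 1)) (s powr a / a)"
  proof (rule has_bochner_integral_nn_integral)
    have I: "((\<lambda>u. u powr (a - 1)) has_integral (s powr a / a)) {0..s}"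
      using has_integral_powr_from_0[of "a - 1" s] a s by simp
    have "(\<integral>\<^sup>+u. indicator {0..s} u * (u powr (a - 1)) \<partial>lborel) = ennreal (s powr a / a)"
      by (rule nn_integral_has_integral_lebesgue[OF _ I]) auto
    then show "(\<integral>\<^sup>+u. ennreal (indicator {0..s} u * u powr (a - 1)) \<partial>lborel) = ennreal (s powr a / a)"
      by simp
  qed (use a in auto)
  have "Beta a b = (\<integral>u. beta_kernel a b u \<partial>lborel)"
    using beta_kernel_has_integral[OF a b0] by (simp add: has_bochner_integral_iff)
  also have "\<dots> \<le> (\<integral>u. indicator {s<..} u * beta_kernel a b u + indicator {0..s} u * u powr (a - 1) \<partial>lborel)"
  proof (intro integral_mono Bochner_Integration.integrable_add integrable_beta_kernel a b0)
    show "integrable lborel (beta_kernel a b)"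
      using beta_kernel_has_integral[OF a b0] by (simp add: has_bochner_integral_iff)
    show "integrable lborel (\<lambda>u. indicator {0..s} u * u powr (a - 1))"
      using powr_int by (simp add: has_bochner_integral_iff)
    fix u :: real
    have "u powr (a - 1) * (1 - u) powr (b - 1) \<le> u powr (a - 1)" if "0 < u" "u < 1"
      using that b by (intro mult_right_le_one_le powr_le1) auto
    then show "beta_kernel a b u \<le> indicator {s<..} u * beta_kernel a b u + indicator {0..s} u * u powr (a - 1)"
      by (auto simp: beta_kernel_def indicator_def)
  qed auto
  also have "\<dots> = beta_upper a b s + s powr a / a"
    unfolding beta_upper_def using powr_int
    by (subst Bochner_Integration.integral_add) (auto intro!: integrable_beta_kernel a b0 simp: has_bochner_integral_iff)
  finally have "Beta a b \<le> 2 * (s powr a / a)" using upper by linarith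
  then show ?thesis by simp
qed

text \<open>
  Beyond twice the mean \<open>s\<close>, comparing the mass of \<open>(r, 2r)\<close> with the bound on \<open>Beta a b\<close> leaves
  the factor \<open>(r / s) powr a \<ge> 1\<close>, so the first parameter disappears from the estimate.
\<close>

lemma beta_tail_ge:
  fixes a b r :: real
  assumes a: "1 / 2 \<le> a" and b: "1 \<le> b" and r: "2 * a / (a + b) \<le> r" "2 * r \<le> 1"
  shows "(1 - 2 * r) powr (b - 1) / 8 \<le> beta_upper a b r / Beta a b"
proof -
  define s where "s = 2 * a / (a + b)"
  have s: "0 < s" using a b by (simp add: s_def)
  have r0: "0 < r" "s \<le> r" using s r by (auto simp: s_def)
  have a0: "0 < a" "0 < b" using a b by auto
  have "(1 - 2 * r) powr (b - 1) / 8 \<le> (a / 4) * ((r powr a / s powr a) * (1 - 2 * r) powr (b - 1))"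
  proof -
    have "1 \<le> r powr a / s powr a" using r0 s a by (simp add: powr_mono2)
    then have "(1/8) * (1 * (1 - 2 * r) powr (b - 1)) \<le> (a / 4) * ((r powr a / s powr a) * (1 - 2 * r) powr (b - 1))"
      using a by (intro mult_mono) auto
    then show ?thesis by simp
  qed
  also have "\<dots> = (r powr a * (1 - 2 * r) powr (b - 1) / 2) / (2 * s powr a / a)"
    using a s by (simp add: field_simps)
  also have "\<dots> \<le> beta_upper a b r / Beta a b"
    using Beta_le_powr[OF a0(1) b] a0 b r r0 Beta_real_pos[OF a0]
    unfolding s_def by (intro frac_le beta_upper_ge order.trans[OF _ beta_upper_ge]) auto
  finally show ?thesis .
qed

lemma p_value_le_1: "p_value n r m k \<le> 1"
  by (simp add: p_value_def cdf_def)

lemma p_value_nonneg: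
  assumes "k \<le> m" "m < n"
  shows "0 \<le> p_value n r m k"
proof (cases "k = m")
  case False
  then have "0 < (real m - real k) / 2" "0 < (real n - real m) / 2" using assms by auto
  then have "0 \<le> 1 - cdf (beta_distribution ((real m - real k) / 2) ((real n - real m) / 2)) r"
    by (simp only: one_minus_cdf_beta) (intro divide_nonneg_nonneg beta_upper_nonneg less_imp_le Beta_real_pos)
  then show ?thesis using False by (simp only: p_value_def if_False)
qed (simp add: p_value_def)

text \<open>
  The mean of the Beta distribution is \<open>(m - k) / (n - k) \<le> m / n\<close>, so \<open>s\<close> lies beyond twice the
  mean and the lower tail bound applies.
\<close>

lemma p_value_ge:
  assumes k: "k < m" "m + 2 \<le> n" and r: "r \<le> s"
    and s: "2 * real m / real n \<le> s" "s \<le> 1 / 4"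
  shows "exp (- (2 * s * real n)) / 8 \<le> p_value n r m k"
proof -
  define a where "a = (real m - real k) / 2"
  define b where "b = (real n - real m) / 2"
  have a: "1 / 2 \<le> a" and b: "1 \<le> b" using k by (auto simp: a_def b_def)
  have s0: "0 \<le> s" using s(1) by (rule order.trans[rotated]) simp
  have "2 * a / (a + b) = 2 * ((real m - real k) / (real n - real k))"
    using k by (simp add: a_def b_def field_simps)
  also have "\<dots> \<le> 2 * (real m / real n)"
  proof -
    have "real k * real m \<le> real k * real n" using k by (intro mult_left_mono) auto
    then show ?thesis using k by (simp add: field_simps)
  qed
  also have "\<dots> \<le> s" using s(1) by simp
  finally have mean: "2 * a / (a + b) \<le> s" .
  have "- (4 * s) \<le> ln (1 - 2 * s)"
  proof -
    have "- (2 * s) - 2 * (2 * s)\<^sup>2 \<le> ln (1 - 2 * s)"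
      using s0 s(2) by (intro ln_one_minus_pos_lower_bound) auto
    moreover have "(2 * s) * (2 * s) \<le> (2 * s) * (1 / 2)"
      using s0 s(2) by (intro mult_left_mono) auto
    ultimately show ?thesis by (simp add: power2_eq_square)
  qed
  then have "(b - 1) * - (4 * s) \<le> (b - 1) * ln (1 - 2 * s)"
    using b by (intro mult_left_mono) auto
  moreover have "(b - 1) * (4 * s) \<le> (real n / 2) * (4 * s)"
    using s0 by (intro mult_right_mono) (auto simp: b_def diff_divide_distrib)
  then have "- (2 * s * real n) \<le> (b - 1) * - (4 * s)" by (simp add: mult.commute)
  ultimately have "- (2 * s * real n) \<le> (b - 1) * ln (1 - 2 * s)" by (rule order.trans[rotated])
  then have "exp (- (2 * s * real n)) / 8 \<le> (1 - 2 * s) powr (b - 1) / 8"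
    using s by (simp add: powr_def)
  also have "\<dots> \<le> beta_upper a b s / Beta a b"
    using a b mean s by (intro beta_tail_ge) auto
  also have "\<dots> \<le> beta_upper a b r / Beta a b"
    using a b r Beta_real_pos[of a b] by (intro divide_right_mono beta_upper_antimono) auto
  also have "\<dots> = p_value n r m k"
    using k a b by (simp add: p_value_def one_minus_cdf_beta flip: a_def b_def)
  finally show ?thesis .
qed

lemma p_value_le:
  assumes k: "k < m" "m + 2 \<le> n" and c: "0 < c" "c < 1" and r: "c \<le> r"
  shows "p_value n r m k
    \<le> exp (ln (2 / c) + real m / 2 * ln (4 / c)
          - ((real n - real m) / 2 - 1) * ln ((1 - c / 2) / (1 - c)))"
proof -
  define a where "a = (real m - real k) / 2"
  define b where "b = (real n - real m) / 2"
  have a: "0 < a" and b: "1 \<le> b" using k by (auto simp: a_def b_def)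
  have ab0: "0 < a" "0 < b" using a b by auto
  have "p_value n r m k = beta_upper a b r / Beta a b"
    using k a b by (simp add: p_value_def one_minus_cdf_beta flip: a_def b_def)
  also have "\<dots> \<le> beta_upper a b c / Beta a b"
    using r Beta_real_pos[OF ab0] by (intro divide_right_mono beta_upper_antimono ab0) auto
  also have "\<dots> \<le> 2 / c * (4 / c) powr a * ((1 - c) / (1 - c / 2)) powr (b - 1)"
    by (rule beta_tail_le[OF a b c])
  also have "\<dots> \<le> 2 / c * (4 / c) powr (real m / 2) * ((1 - c) / (1 - c / 2)) powr (b - 1)"
    using c by (intro mult_right_mono mult_left_mono powr_mono) (auto simp: a_def)
  also have "\<dots> = exp (ln (2 / c) + real m / 2 * ln (4 / c) - (b - 1) * ln ((1 - c / 2) / (1 - c)))"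
  proof -
    have "ln ((1 - c) / (1 - c / 2)) = - ln ((1 - c / 2) / (1 - c))"
      using c by (simp add: ln_div)
    then have "((1 - c) / (1 - c / 2)) powr (b - 1) = exp (- ((b - 1) * ln ((1 - c / 2) / (1 - c))))"
      using c by (simp add: powr_def)
    moreover have "exp (ln (2 / c)) = 2 / c" "(4 / c) powr (real m / 2) = exp (real m / 2 * ln (4 / c))"
      using c by (simp_all add: powr_def)
    ultimately have "2 / c * (4 / c) powr (real m / 2) * ((1 - c) / (1 - c / 2)) powr (b - 1)
        = exp (ln (2 / c)) * exp (real m / 2 * ln (4 / c)) * exp (- ((b - 1) * ln ((1 - c / 2) / (1 - c))))"
      by (simp only:)
    then show ?thesis by (simp only: exp_add[symmetric] diff_conv_add_uminus)
  qed
  finally show ?thesis by (simp add: b_def)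
qed

section \<open>Quadratic forms of Gaussian noise\<close>

text \<open>Independence and mean zero make the cross terms of the expanded square vanish.\<close>

lemma (in prob_space) weighted_sum_second_moment:
  fixes Z :: "'i \<Rightarrow> 'a \<Rightarrow> real"
  assumes I: "finite I" and indep: "indep_vars (\<lambda>_. borel) Z I"
    and mean: "\<And>i. i \<in> I \<Longrightarrow> has_bochner_integral M (Z i) 0"
    and second: "\<And>i. i \<in> I \<Longrightarrow> has_bochner_integral M (\<lambda>\<omega>. (Z i \<omega>)\<^sup>2) v"
  shows "has_bochner_integral M (\<lambda>\<omega>. (\<Sum>i\<in>I. c i * Z i \<omega>)\<^sup>2) (v * (\<Sum>i\<in>I. (c i)\<^sup>2))"
proof -
  have pair: "has_bochner_integral M (\<lambda>\<omega>. Z i \<omega> * Z k \<omega>) (if i = k then v else 0)"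
    if "i \<in> I" "k \<in> I" for i k
  proof (cases "i = k")
    case True
    then show ?thesis using second[OF that(1)] by (simp add: power2_eq_square)
  next
    case False
    have ik: "indep_vars (\<lambda>_. borel) Z {i, k}"
      by (rule indep_vars_subset[OF indep]) (use that in auto)
    have int: "integrable M (Z j)" if "j \<in> {i, k}" for j
      using mean that \<open>i \<in> I\<close> \<open>k \<in> I\<close> by (auto simp: has_bochner_integral_iff)
    have "integrable M (\<lambda>\<omega>. \<Prod>j\<in>{i, k}. Z j \<omega>)"
      by (rule indep_vars_integrable[OF _ ik int]) auto
    moreover have "(\<integral>\<omega>. (\<Prod>j\<in>{i, k}. Z j \<omega>) \<partial>M) = (\<Prod>j\<in>{i, k}. \<integral>\<omega>. Z j \<omega> \<partial>M)"
      by (rule indep_vars_lebesgue_integral[OF _ ik int]) auto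
    ultimately show ?thesis
      using False mean[OF that(1)] by (simp add: has_bochner_integral_iff)
  qed
  have "has_bochner_integral M (\<lambda>\<omega>. \<Sum>i\<in>I. \<Sum>k\<in>I. (c i * c k) * (Z i \<omega> * Z k \<omega>))
      (\<Sum>i\<in>I. \<Sum>k\<in>I. (c i * c k) * (if i = k then v else 0))"
    by (intro has_bochner_integral_sum has_bochner_integral_mult_right pair)
  also have "(\<lambda>\<omega>. \<Sum>i\<in>I. \<Sum>k\<in>I. (c i * c k) * (Z i \<omega> * Z k \<omega>)) = (\<lambda>\<omega>. (\<Sum>i\<in>I. c i * Z i \<omega>)\<^sup>2)"
    by (simp add: power2_eq_square sum_product mult_ac)
  also have "(\<Sum>i\<in>I. \<Sum>k\<in>I. (c i * c k) * (if i = k then v else 0)) = v * (\<Sum>i\<in>I. (c i)\<^sup>2)"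
    using I by (simp add: if_distrib power2_eq_square sum_distrib_left mult_ac cong: if_cong)
  finally show ?thesis .
qed

lemma normal_moments:
  assumes "0 < \<sigma>" and D: "distributed M lborel X (normal_density 0 \<sigma>)"
  shows "has_bochner_integral M X 0"
    and "has_bochner_integral M (\<lambda>\<omega>. (X \<omega>)\<^sup>2) (\<sigma>\<^sup>2)"
    and "has_bochner_integral M (\<lambda>\<omega>. (X \<omega>) ^ 4) (3 * \<sigma> ^ 4)"
proof -
  have transfer: "has_bochner_integral M (\<lambda>\<omega>. X \<omega> ^ k) v"
    if "has_bochner_integral lborel (\<lambda>u. normal_density 0 \<sigma> u * u ^ k) v" for k v
    using that distributed_integrable[OF D, of "\<lambda>u. u ^ k"] distributed_integral[OF D, of "\<lambda>u. u ^ k"]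
    by (simp add: has_bochner_integral_iff)
  show "has_bochner_integral M X 0"
    using transfer[of 1] normal_moment_odd[OF assms(1), of 0 0] by simp
  show "has_bochner_integral M (\<lambda>\<omega>. (X \<omega>)\<^sup>2) (\<sigma>\<^sup>2)"
    using transfer[of 2] normal_moment_even[OF assms(1), of 0 1] by (simp add: fact_numeral)
  show "has_bochner_integral M (\<lambda>\<omega>. (X \<omega>) ^ 4) (3 * \<sigma> ^ 4)"
    using transfer[of 4] normal_moment_even[OF assms(1), of 0 2] 
    by (simp add: fact_numeral power_divide flip: power_mult)
qed

locale gaussian_noise = prob_space +
  fixes n :: nat and \<sigma> :: real and \<epsilon> :: "nat \<Rightarrow> 'a \<Rightarrow> real"
  assumes \<sigma>_pos: "0 < \<sigma>"
    and indep: "indep_vars (\<lambda>_. borel) \<epsilon> {1..n}"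
    and normal: "\<And>l. l \<in> {1..n} \<Longrightarrow> distributed M lborel (\<epsilon> l) (normal_density 0 \<sigma>)"
begin

lemma noise_measurable [measurable]: "l \<in> {1..n} \<Longrightarrow> \<epsilon> l \<in> borel_measurable M"
  using distributed_measurable[OF normal] by simp

lemma dot_measurable [measurable]: "(\<lambda>\<omega>. dot n q (\<lambda>l. \<epsilon> l \<omega>)) \<in> borel_measurable M"
  unfolding dot_def by (intro borel_measurable_sum borel_measurable_times noise_measurable) auto

lemma dot_self_measurable [measurable]: "(\<lambda>\<omega>. dot n (\<lambda>l. \<epsilon> l \<omega>) (\<lambda>l. \<epsilon> l \<omega>)) \<in> borel_measurable M"
  unfolding dot_def by (intro borel_measurable_sum borel_measurable_times noise_measurable) auto

text \<open>
  Markov's inequality; each of the \<open>card J\<close> coordinates of the projected noise has second moment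
  at most \<open>\<sigma>\<^sup>2\<close>.
\<close>

lemma prob_projection_ge:
  assumes J: "finite J" and q: "\<And>k. k \<in> J \<Longrightarrow> dot n (q k) (q k) \<le> 1" and d: "0 < d"
  shows "prob {\<omega> \<in> space M. d \<le> (\<Sum>k\<in>J. (dot n (q k) (\<lambda>l. \<epsilon> l \<omega>))\<^sup>2)} \<le> \<sigma>\<^sup>2 * real (card J) / d"
proof -
  have "has_bochner_integral M (\<lambda>\<omega>. (dot n (q k) (\<lambda>l. \<epsilon> l \<omega>))\<^sup>2) (\<sigma>\<^sup>2 * dot n (q k) (q k))" for k
    using weighted_sum_second_moment[OF _ indep, of "\<sigma>\<^sup>2" "q k"] normal_moments[OF \<sigma>_pos normal]
    by (simp add: dot_def power2_eq_square)
  then have int: "has_bochner_integral M (\<lambda>\<omega>. \<Sum>k\<in>J. (dot n (q k) (\<lambda>l. \<epsilon> l \<omega>))\<^sup>2)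
      (\<Sum>k\<in>J. \<sigma>\<^sup>2 * dot n (q k) (q k))"
    by (intro has_bochner_integral_sum) auto
  have "prob {\<omega> \<in> space M. d \<le> (\<Sum>k\<in>J. (dot n (q k) (\<lambda>l. \<epsilon> l \<omega>))\<^sup>2)}
      \<le> (\<integral>\<omega>. (\<Sum>k\<in>J. (dot n (q k) (\<lambda>l. \<epsilon> l \<omega>))\<^sup>2) \<partial>M) / d"
    using int d by (intro integral_Markov_inequality_measure[where A = "{}"])
      (auto simp: has_bochner_integral_iff intro!: sum_nonneg)
  also have "\<dots> = (\<Sum>k\<in>J. \<sigma>\<^sup>2 * dot n (q k) (q k)) / d"
    using int by (simp add: has_bochner_integral_iff)
  also have "\<dots> \<le> (\<Sum>k\<in>J. \<sigma>\<^sup>2 * 1) / d"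
    using q d by (intro divide_right_mono sum_mono mult_left_mono) auto
  finally show ?thesis by (simp add: mult.commute)
qed

text \<open>
  Chebyshev's inequality for a sum of \<open>n\<close> independent terms of variance
  \<open>3 \<sigma>\<^sup>4 - \<sigma>\<^sup>4 = 2 \<sigma>\<^sup>4\<close>.
\<close>

lemma prob_noise_norm_deviation:
  assumes d: "0 < d"
  shows "prob {\<omega> \<in> space M. d \<le> \<bar>dot n (\<lambda>l. \<epsilon> l \<omega>) (\<lambda>l. \<epsilon> l \<omega>) - real n * \<sigma>\<^sup>2\<bar>}
    \<le> 2 * \<sigma> ^ 4 * real n / d\<^sup>2"
proof -
  let ?Z = "\<lambda>l \<omega>. (\<epsilon> l \<omega>)\<^sup>2 - \<sigma>\<^sup>2"
  let ?D = "\<lambda>\<omega>. dot n (\<lambda>l. \<epsilon> l \<omega>) (\<lambda>l. \<epsilon> l \<omega>) - real n * \<sigma>\<^sup>2"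
  have Z_indep: "indep_vars (\<lambda>_. borel) ?Z {1..n}"
    by (rule indep_vars_compose2[OF indep, of "\<lambda>_ u. u\<^sup>2 - \<sigma>\<^sup>2"]) auto
  have const: "has_bochner_integral M (\<lambda>_. c) c" for c :: real
    using prob_space by (simp add: has_bochner_integral_iff)
  have Z_mean: "has_bochner_integral M (?Z l) 0" if "l \<in> {1..n}" for l
    using has_bochner_integral_diff[OF normal_moments(2)[OF \<sigma>_pos normal[OF that]] const[of "\<sigma>\<^sup>2"]]
    by simp
  have Z_second: "has_bochner_integral M (\<lambda>\<omega>. (?Z l \<omega>)\<^sup>2) (2 * \<sigma> ^ 4)" if "l \<in> {1..n}" for l
  proof -
    have "has_bochner_integral M (\<lambda>\<omega>. (\<epsilon> l \<omega>) ^ 4 - (2 * \<sigma>\<^sup>2) * (\<epsilon> l \<omega>)\<^sup>2 + \<sigma> ^ 4)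
        (3 * \<sigma> ^ 4 - (2 * \<sigma>\<^sup>2) * \<sigma>\<^sup>2 + \<sigma> ^ 4)"
      by (intro has_bochner_integral_add has_bochner_integral_diff has_bochner_integral_mult_right
          const normal_moments[OF \<sigma>_pos normal[OF that]])
    then show ?thesis
      by (simp add: power2_eq_square power4_eq_xxxx algebra_simps)
  qed
  have D_eq: "?D \<omega> = (\<Sum>l\<in>{1..n}. 1 * ?Z l \<omega>)" for \<omega>
    by (simp add: dot_def sum_subtractf power2_eq_square)
  have D_int: "has_bochner_integral M (\<lambda>\<omega>. (?D \<omega>)\<^sup>2) (2 * \<sigma> ^ 4 * (\<Sum>l\<in>{1..n}. 1\<^sup>2))"
    unfolding D_eq
    by (rule weighted_sum_second_moment[OF _ Z_indep Z_mean Z_second]) auto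
  have "prob {\<omega> \<in> space M. d \<le> \<bar>?D \<omega>\<bar>} \<le> (\<integral>\<omega>. (?D \<omega>)\<^sup>2 \<partial>M) / d\<^sup>2"
    using D_int d by (intro second_moment_method) (auto simp: has_bochner_integral_iff)
  then show ?thesis using D_int by (simp add: has_bochner_integral_iff)
qed

lemma prob_good_event:
  assumes J: "finite J" and q: "\<And>k. k \<in> J \<Longrightarrow> dot n (q k) (q k) \<le> 1" and d: "0 < d" and n: "1 \<le> n"
  shows "1 - (\<sigma>\<^sup>2 * real (card J) / d + 8 / real n)
    \<le> prob {\<omega> \<in> space M. (\<Sum>k\<in>J. (dot n (q k) (\<lambda>l. \<epsilon> l \<omega>))\<^sup>2) < d \<and>
         \<bar>dot n (\<lambda>l. \<epsilon> l \<omega>) (\<lambda>l. \<epsilon> l \<omega>) - real n * \<sigma>\<^sup>2\<bar> < real n * \<sigma>\<^sup>2 / 2}"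
    (is "_ \<le> prob ?good")
proof -
  let ?A = "{\<omega> \<in> space M. d \<le> (\<Sum>k\<in>J. (dot n (q k) (\<lambda>l. \<epsilon> l \<omega>))\<^sup>2)}"
  let ?B = "{\<omega> \<in> space M. real n * \<sigma>\<^sup>2 / 2 \<le> \<bar>dot n (\<lambda>l. \<epsilon> l \<omega>) (\<lambda>l. \<epsilon> l \<omega>) - real n * \<sigma>\<^sup>2\<bar>}"
  have A [measurable]: "?A \<in> sets M" by measurable
  have B [measurable]: "?B \<in> sets M" by measurable
  have "1 - prob ?good = prob (space M - ?good)"
    by (rule prob_compl[symmetric]) measurable
  also have "\<dots> \<le> prob (?A \<union> ?B)"
    by (rule finite_measure_mono) auto
  also have "\<dots> \<le> prob ?A + prob ?B"
    by (rule measure_Un_le) measurable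
  also have "prob ?A \<le> \<sigma>\<^sup>2 * real (card J) / d"
    by (rule prob_projection_ge[OF J q d])
  also have "prob ?B \<le> 2 * \<sigma> ^ 4 * real n / (real n * \<sigma>\<^sup>2 / 2)\<^sup>2"
    using n \<sigma>_pos by (intro prob_noise_norm_deviation) auto
  also have "\<dots> = 8 / real n"
    using n \<sigma>_pos by (simp add: field_simps power2_eq_square power4_eq_xxxx)
  finally show ?thesis by simp
qed

end

section \<open>Residual sums of squares in the regression model\<close>

lemma response_eq_fit: "response x m \<beta> e l = fit x {1..m} \<beta> l + e l"
  by (simp add: response_def fit_def)

lemma fit_true_model:
  assumes "true_model \<beta> \<subseteq> {1..m}"
  shows "fit x {1..m} \<beta> = fit x (true_model \<beta>) \<beta>"
  unfolding fit_def using assms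
  by (intro ext sum.mono_neutral_right) (auto simp: true_model_def)

lemma RSS_true_model_le:
  assumes t: "true_model \<beta> \<subseteq> {1..m}"
  shows "RSS n x (response x m \<beta> e) (true_model \<beta>) \<le> dot n e e"
proof -
  have "finite (true_model \<beta>)" using t by (rule finite_subset) simp
  then have "RSS n x (response x m \<beta> e) (true_model \<beta>)
      \<le> sq_residuals n x (response x m \<beta> e) (true_model \<beta>) \<beta>"
    by (rule RSS_le)
  also have "\<dots> = dot n e e"
    using fit_true_model[OF t, of x] by (simp add: sq_residuals_eq_dot response_eq_fit)
  finally show ?thesis .
qed

text \<open>Expand \<open>0 \<le> dot n (u + 2 v) (u + 2 v)\<close>.\<close>

lemma dot_add_ge: "dot n u u / 2 - dot n v v \<le> dot n (\<lambda>l. u l + v l) (\<lambda>l. u l + v l)"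
proof -
  have "0 \<le> dot n (\<lambda>l. u l + 2 * v l) (\<lambda>l. u l + 2 * v l)" by simp
  then show ?thesis by (simp add: dot_linear dot_commute[of n v u])
qed

text \<open>
  Split the noise \<open>e\<close> into its fit \<open>h\<close> by the full model and a rest \<open>s\<close> orthogonal to all
  regressors. The full model leaves exactly \<open>s\<close>, and a submodel with coefficients \<open>b\<close> leaves
  \<open>s\<close> plus the fit of \<open>\<beta> - b\<close> plus \<open>h\<close>; the two parts are orthogonal.
\<close>

lemma
  assumes q: "projection_basis n x {1..m} q" and j: "j \<subseteq> {1..m}"
  shows RSS_full_model: "RSS n x (response x m \<beta> e) {1..m} = dot n e e - (\<Sum>k=1..m. (dot n (q k) e)\<^sup>2)"
    and RSS_excess_ge: "\<exists>b. (\<forall>i. i \<notin> j \<longrightarrow> b i = 0) \<and>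
        dot n (fit x {1..m} (\<lambda>i. \<beta> i - b i)) (fit x {1..m} (\<lambda>i. \<beta> i - b i)) / 2
          - (\<Sum>k=1..m. (dot n (q k) e)\<^sup>2)
        \<le> RSS n x (response x m \<beta> e) j - RSS n x (response x m \<beta> e) {1..m}"
proof -
  let ?f = "{1..m}" and ?y = "response x m \<beta> e"
  obtain p where p: "\<And>i. i \<in> ?f \<Longrightarrow> dot n (\<lambda>l. e l - fit x ?f p l) (\<lambda>l. x l i) = 0"
    and p_norm: "dot n (fit x ?f p) (fit x ?f p) = (\<Sum>k\<in>?f. (dot n (q k) e)\<^sup>2)"
    using q unfolding projection_basis_def by blast
  define h where "h = fit x ?f p"
  define s where "s = (\<lambda>l. e l - h l)"
  have s_orth: "dot n s (fit x ?f c) = 0" for c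
    by (rule dot_fit_right_eq_0) (use p in \<open>auto simp: s_def h_def\<close>)
  have resid: "(\<lambda>l. ?y l - fit x ?f (\<lambda>i. \<beta> i + p i) l) = s"
    by (simp add: fit_add response_eq_fit s_def h_def fun_eq_iff)
  have full: "RSS n x ?y ?f = dot n s s"
    using RSS_normal_equations(1)[of ?f n ?y x "\<lambda>i. \<beta> i + p i"] p
    unfolding resid by (simp add: s_def h_def)
  have e: "e = (\<lambda>l. h l + s l)" by (simp add: s_def)
  have sh: "dot n s h = 0" unfolding h_def by (rule s_orth)
  have "dot n e e = dot n h h + dot n s s"
    using sh by (subst (1 2) e) (simp add: dot_add_left dot_add_right dot_commute[of n h s])
  then show "RSS n x ?y ?f = dot n e e - (\<Sum>k=1..m. (dot n (q k) e)\<^sup>2)"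
    using full p_norm by (simp add: h_def)
  have "finite j" using j by (rule finite_subset) simp
  then obtain b where b: "\<And>i. i \<in> j \<Longrightarrow> dot n (\<lambda>l. ?y l - fit x j b l) (\<lambda>l. x l i) = 0"
    using orthogonal_projection_exists[of j n x] unfolding projection_basis_def by blast
  define b' where "b' = (\<lambda>i. if i \<in> j then b i else 0)"
  define u where "u = fit x ?f (\<lambda>i. \<beta> i - b' i)"
  have su: "dot n s u = 0" unfolding u_def by (rule s_orth)
  have fit_b: "fit x j b = fit x ?f b'"
    unfolding b'_def using j by (intro fit_extend) auto
  have "(\<lambda>l. ?y l - fit x j b l) = (\<lambda>l. (u l + h l) + s l)"
    by (intro ext) (simp add: fit_b u_def fit_diff response_eq_fit s_def)
  then have "RSS n x ?y j = dot n (\<lambda>l. (u l + h l) + s l) (\<lambda>l. (u l + h l) + s l)"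
    using RSS_normal_equations(1)[OF b] by (simp only:)
  also have "\<dots> = dot n (\<lambda>l. u l + h l) (\<lambda>l. u l + h l) + dot n s s"
    using sh su by (simp add: dot_add_left dot_add_right dot_commute[of n u s] dot_commute[of n h s])
  finally have "dot n u u / 2 - dot n h h \<le> RSS n x ?y j - RSS n x ?y ?f"
    using dot_add_ge[of n u h] full by simp
  then show "\<exists>b. (\<forall>i. i \<notin> j \<longrightarrow> b i = 0) \<and>
        dot n (fit x {1..m} (\<lambda>i. \<beta> i - b i)) (fit x {1..m} (\<lambda>i. \<beta> i - b i)) / 2
          - (\<Sum>k=1..m. (dot n (q k) e)\<^sup>2)
        \<le> RSS n x ?y j - RSS n x ?y {1..m}"
    using p_norm by (intro exI[of _ b']) (auto simp: b'_def u_def h_def)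
qed

text \<open>
  A model without \<open>i\<close> gets the coefficient \<open>\<beta> i\<close> wrong by its full size. The bound depends
  on the model in no other way, which makes it uniform over all models that miss \<open>i\<close>.
\<close>

lemma RSS_missing_regressor:
  assumes q: "projection_basis n x {1..m} q" and j: "j \<subseteq> {1..m}"
    and i: "i \<in> {1..m}" "i \<notin> j" and n: "1 \<le> n" and \<kappa>: "0 < \<kappa>"
    and ev: "\<kappa> < min_eigenvalue (normalized_gram n m x)"
  shows "real n * \<kappa> * (\<beta> i)\<^sup>2 / 2 - (\<Sum>k=1..m. (dot n (q k) e)\<^sup>2)
    \<le> RSS n x (response x m \<beta> e) j - RSS n x (response x m \<beta> e) {1..m}"
proof -
  obtain b where b: "\<And>i. i \<notin> j \<Longrightarrow> b i = 0"
    and le: "dot n (fit x {1..m} (\<lambda>i. \<beta> i - b i)) (fit x {1..m} (\<lambda>i. \<beta> i - b i)) / 2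
          - (\<Sum>k=1..m. (dot n (q k) e)\<^sup>2)
        \<le> RSS n x (response x m \<beta> e) j - RSS n x (response x m \<beta> e) {1..m}"
    using RSS_excess_ge[OF q j] by blast
  have "(\<beta> i)\<^sup>2 \<le> (\<Sum>i=1..m. (\<beta> i - b i)\<^sup>2)"
    using member_le_sum[of i "{1..m}" "\<lambda>i. (\<beta> i - b i)\<^sup>2"] i b by simp
  then have "real n * \<kappa> * (\<beta> i)\<^sup>2 \<le> real n * \<kappa> * (\<Sum>i=1..m. (\<beta> i - b i)\<^sup>2)"
    using \<kappa> by (intro mult_left_mono) auto
  also have "\<dots> \<le> dot n (fit x {1..m} (\<lambda>i. \<beta> i - b i)) (fit x {1..m} (\<lambda>i. \<beta> i - b i))"
    using i by (intro fit_norm_ge[OF _ n ev]) auto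
  finally show ?thesis using le by linarith
qed

section \<open>Consistency of the criterion\<close>

lemma mpvc_choice_eqI:
  assumes choice: "is_mpvc_choice \<M> n m a x y J" and t: "t \<in> \<M>"
    and best: "\<And>j. j \<in> \<M> \<Longrightarrow> j \<noteq> t \<Longrightarrow> mpvc_score n m a x y j < mpvc_score n m a x y t"
  shows "J = t"
proof (rule ccontr)
  assume "J \<noteq> t"
  have "is_arg_max (mpvc_score n m a x y) (\<lambda>j. j \<in> \<M>) J"
    using choice by (simp add: is_mpvc_choice_def is_arg_min_def)
  then show False
    using best[of J] t \<open>J \<noteq> t\<close> by (auto simp: is_arg_max_def)
qed

lemma divide_le_divideI:
  fixes p q r s :: real
  assumes "p * s \<le> r * q" "0 < q" "0 < s"
  shows "p / q \<le> r / s"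
  using assms by (simp add: field_simps)

text \<open>
  The deterministic core: once the noise has typical size, the criterion selects the true model.
  A model with more than \<open>card t\<close> elements pays at least one more factor
  \<open>exp (- a)\<close> in the penalty, which a \<open>p\<close>-value of the true model above \<open>exp (- a / 2)\<close> does not
  let it recover. Any other model misses a regressor of \<open>t\<close>, has an \<open>R_coeff\<close> of at least \<open>c\<close>, and
  its \<open>p\<close>-value alone is below \<open>exp (- (card t + 1) * a)\<close> by the hypothesis \<open>tail\<close>.
\<close>

lemma mpvc_selects_true_model:
  fixes \<beta> e :: "nat \<Rightarrow> real"
  defines "t \<equiv> true_model \<beta>"
  assumes q: "projection_basis n x {1..m} q"
    and t_sub: "t \<subseteq> {1..m}"
    and n: "m + 2 \<le> n"
    and a: "32 \<le> a" "16 * real m \<le> a" "a \<le> 2 * real n"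
    and \<sigma>: "0 < \<sigma>"
    and G: "(\<Sum>k=1..m. (dot n (q k) e)\<^sup>2) < \<sigma>\<^sup>2 * a / 32"
    and S: "\<bar>dot n e e - real n * \<sigma>\<^sup>2\<bar> < real n * \<sigma>\<^sup>2 / 2"
    and \<kappa>: "0 < \<kappa>" and ev: "1 \<le> m \<Longrightarrow> \<kappa> < min_eigenvalue (normalized_gram n m x)"
    and v: "0 < v" "\<And>i. i \<in> t \<Longrightarrow> v \<le> (\<beta> i)\<^sup>2"
    and d: "d = \<kappa> * v / 4" "\<sigma>\<^sup>2 * a / 32 \<le> real n * d"
    and c: "c = d / (d + 2 * \<sigma>\<^sup>2)"
    and tail: "ln (2 / c) + real m / 2 * ln (4 / c)
          - ((real n - real m) / 2 - 1) * ln ((1 - c / 2) / (1 - c)) < - (real (card t + 1) * a)"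
    and choice: "is_mpvc_choice (Pow {1..m}) n m a x (response x m \<beta> e) J"
  shows "J = t"
proof (rule mpvc_choice_eqI[OF choice])
  let ?y = "response x m \<beta> e"
  let ?f = "{1..m}"
  define F where "F = RSS n x ?y ?f"
  have t_fin: "finite t" using t_sub by (rule finite_subset) simp
  have npos: "0 < real n" using n by simp
  have F_eq: "F = dot n e e - (\<Sum>k=1..m. (dot n (q k) e)\<^sup>2)"
    unfolding F_def by (rule RSS_full_model[OF q order.refl])
  have G_small: "\<sigma>\<^sup>2 * a / 32 \<le> real n * \<sigma>\<^sup>2 / 4"
  proof -
    have "\<sigma>\<^sup>2 * a / 32 \<le> \<sigma>\<^sup>2 * (8 * real n) / 32"
      using a by (intro divide_right_mono mult_left_mono) auto
    then show ?thesis by (simp add: mult.commute)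
  qed
  have norm_e: "real n * \<sigma>\<^sup>2 / 2 < dot n e e" "dot n e e < 3 * (real n * \<sigma>\<^sup>2) / 2"
    using S unfolding abs_less_iff by linarith+
  have F_ge: "real n * \<sigma>\<^sup>2 / 4 \<le> F"
    using F_eq G G_small norm_e by linarith
  have F_le: "F \<le> 2 * real n * \<sigma>\<^sup>2"
  proof -
    have "0 \<le> (\<Sum>k=1..m. (dot n (q k) e)\<^sup>2)" by (intro sum_nonneg) auto
    moreover have "0 \<le> real n * \<sigma>\<^sup>2" by simp
    ultimately show ?thesis using F_eq norm_e by linarith
  qed
  have F_pos: "0 < F" by (rule less_le_trans[OF _ F_ge]) (use npos \<sigma> in simp)
  have p_t: "exp (- a / 2) < p_value n (R_coeff n x ?y t ?f) m (card t)"
  proof (cases "card t = m")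
    case True
    then show ?thesis using a by (simp add: p_value_def)
  next
    case False
    have "card t \<le> m" using card_mono[OF _ t_sub] by simp
    with False have less: "card t < m" by simp
    define T where "T = RSS n x ?y t"
    have T: "F \<le> T" "T \<le> dot n e e"
      unfolding T_def F_def t_def
      using RSS_mono[OF _ t_sub] RSS_true_model_le t_sub by (auto simp: t_def)
    have "R_coeff n x ?y t ?f = (T - F) / T"
      by (simp add: R_coeff_def T_def F_def)
    also have "\<dots> \<le> (\<sigma>\<^sup>2 * a / 32) / (real n * \<sigma>\<^sup>2 / 4)"
      using T F_eq F_ge G npos \<sigma> a by (intro frac_le) auto
    also have "\<dots> = a / (8 * real n)" using \<sigma> npos by (simp add: field_simps)
    finally have R: "R_coeff n x ?y t ?f \<le> a / (8 * real n)" .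
    \<comment> \<open>The bound \<open>R \<le> a / (8 n)\<close> leaves a \<open>p\<close>-value of at least \<open>exp (- a / 4) / 8\<close>, and the
      factor \<open>8\<close> is absorbed because \<open>a \<ge> 32\<close>.\<close>
    have "exp (- (2 * (a / (8 * real n)) * real n)) / 8 \<le> p_value n (R_coeff n x ?y t ?f) m (card t)"
      using npos a by (intro p_value_ge less n R) (auto simp: field_simps)
    moreover have "exp (- (2 * (a / (8 * real n)) * real n)) = exp (- a / 2) * exp (a / 4)"
      using npos by (simp flip: exp_add)
    moreover have "8 < exp (a / 4)"
      using exp_ge_add_one_self[of "a / 4"] a(1) by linarith
    then have "exp (- a / 2) * 8 < exp (- a / 2) * exp (a / 4)" by simp
    ultimately show ?thesis by linarith
  qed
  have score_t: "exp (- (real (card t) * a)) * exp (- a / 2) < mpvc_score n m a x ?y t"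
    unfolding mpvc_score_def using p_t by simp
  show "t \<in> Pow ?f" using t_sub by simp
  fix j assume j: "j \<in> Pow ?f" "j \<noteq> t"
  then have j_sub: "j \<subseteq> ?f" and j_fin: "finite j" by (auto intro: finite_subset)
  have "mpvc_score n m a x ?y j \<le> exp (- (real (card t + 1) * a))"
  proof (cases "card t < card j")
    case True
    have "mpvc_score n m a x ?y j \<le> exp (- (real (card j) * a))"
      unfolding mpvc_score_def using p_value_nonneg[of "card j" m n] card_mono[OF _ j_sub] n
      by (intro mult_right_le_one_le p_value_le_1) auto
    also have "\<dots> \<le> exp (- (real (card t + 1) * a))"
      using True a by (simp add: mult_right_mono)
    finally show ?thesis .
  next
    case False
    have "\<not> t \<subseteq> j"
      using False j(2) card_mono[OF j_fin, of t] card_subset_eq[OF j_fin, of t] by auto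
    then obtain i where i: "i \<in> t" "i \<notin> j" by blast
    have "j \<noteq> ?f" using i t_sub by auto
    then have less: "card j < m" using j_sub psubset_card_mono[of ?f j] by auto
    define D where "D = RSS n x ?y j - F"
    have dpos: "0 < d" unfolding d(1) using \<kappa> v(1) by simp
    have "real n * \<kappa> * v / 2 \<le> real n * \<kappa> * (\<beta> i)\<^sup>2 / 2"
      using v(2)[OF i(1)] \<kappa> by (intro divide_right_mono mult_left_mono) auto
    moreover have "real n * \<kappa> * (\<beta> i)\<^sup>2 / 2 - (\<Sum>k=1..m. (dot n (q k) e)\<^sup>2) \<le> D"
      unfolding D_def F_def using i t_sub less n
      by (intro RSS_missing_regressor[OF q j_sub _ _ _ \<kappa>] ev) auto
    moreover have "real n * \<kappa> * v / 2 = 2 * (real n * d)" using d by simp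
    ultimately have D: "real n * d \<le> D" using G d(2) by linarith
    have D_pos: "0 < D" by (rule less_le_trans[OF _ D]) (use npos dpos in simp)
    have "0 < d + 2 * \<sigma>\<^sup>2" using dpos \<sigma> by (intro add_pos_pos) auto
    then have c01: "0 < c" "c < 1" using c dpos \<sigma> by auto
    \<comment> \<open>With excess \<open>D\<close> over the full model \<open>R_coeff\<close> is \<open>D / (D + F)\<close>, increasing in \<open>D\<close> and
      decreasing in \<open>F\<close>.\<close>
    have "c = (real n * d) / (real n * (d + 2 * \<sigma>\<^sup>2))"
      unfolding c using npos by simp
    also have "\<dots> \<le> D / (D + F)"
    proof -
      have "(real n * d) * F \<le> D * (2 * real n * \<sigma>\<^sup>2)"
        using D D_pos F_le F_pos by (intro mult_mono) auto
      then have "(real n * d) * (D + F) \<le> D * (real n * (d + 2 * \<sigma>\<^sup>2))"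
        by (simp add: algebra_simps)
      moreover have "0 < real n * d" "0 < real n * (d + 2 * \<sigma>\<^sup>2)"
        using npos dpos \<open>0 < d + 2 * \<sigma>\<^sup>2\<close> by simp_all
      moreover have "0 < D + F" using D_pos F_pos by simp
      ultimately show ?thesis by (intro divide_le_divideI)
    qed
    also have "\<dots> = R_coeff n x ?y j ?f"
      by (simp add: R_coeff_def D_def F_def)
    finally have R: "c \<le> R_coeff n x ?y j ?f" .
    have "0 \<le> p_value n (R_coeff n x ?y j ?f) m (card j)"
      using less n by (intro p_value_nonneg) auto
    then have "mpvc_score n m a x ?y j \<le> p_value n (R_coeff n x ?y j ?f) m (card j)"
      unfolding mpvc_score_def using a by (intro mult_left_le_one_le) auto
    also have "\<dots> \<le> exp (ln (2 / c) + real m / 2 * ln (4 / c)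
          - ((real n - real m) / 2 - 1) * ln ((1 - c / 2) / (1 - c)))"
      by (rule p_value_le[OF less n c01 R])
    also have "\<dots> \<le> exp (- (real (card t + 1) * a))"
      using tail by simp
    finally show ?thesis .
  qed
  also have "\<dots> \<le> exp (- (real (card t) * a)) * exp (- a / 2)"
    using a by (simp add: algebra_simps flip: exp_add)
  also note score_t
  finally show "mpvc_score n m a x ?y j < mpvc_score n m a x ?y t" .
qed

text \<open>
  The limit exists in the extended reals by monotonicity. As \<open>M\<close> is integer-valued, a limit of at
  least \<open>Max t\<close> means that this value is reached, also when \<open>M\<close> is bounded.
\<close>

lemma eventually_subset_of_lim_ge_Max:
  fixes M :: "nat \<Rightarrow> nat"
  assumes "mono M" and t: "finite t" "\<And>i. i \<in> t \<Longrightarrow> 1 \<le> i"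
    and lim: "ereal (real (if t = {} then 0 else Max t)) \<le> lim (\<lambda>n. ereal (real (M n)))"
  shows "\<forall>\<^sub>F n in sequentially. t \<subseteq> {1..M n}"
proof (cases "t = {}")
  case False
  have "\<exists>N. Max t \<le> M N"
  proof (rule ccontr)
    assume "\<nexists>N. Max t \<le> M N"
    then have less: "M n < Max t" for n by (meson not_le)
    have "incseq (\<lambda>n. ereal (real (M n)))"
      using \<open>mono M\<close> by (auto simp: mono_def)
    then have "(\<lambda>n. ereal (real (M n))) \<longlonglongrightarrow> (SUP n. ereal (real (M n)))"
      by (rule LIMSEQ_SUP)
    then have "lim (\<lambda>n. ereal (real (M n))) = (SUP n. ereal (real (M n)))"
      by (rule limI)
    also have "\<dots> \<le> ereal (real (Max t) - 1)"
    proof (rule SUP_least)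
      fix n
      have "real (M n) + 1 \<le> real (Max t)" using less[of n] by linarith
      then show "ereal (real (M n)) \<le> ereal (real (Max t) - 1)" by simp
    qed
    finally show False using lim False by (auto dest: order.trans)
  qed
  then obtain N where N: "Max t \<le> M N" by blast
  have "t \<subseteq> {1..M n}" if "N \<le> n" for n
  proof
    fix i assume "i \<in> t"
    then have "i \<le> Max t" using t(1) by simp
    also note N
    also have "M N \<le> M n" using \<open>mono M\<close> that by (rule monoD)
    finally show "i \<in> {1..M n}" using t(2)[OF \<open>i \<in> t\<close>] by simp
  qed
  then show ?thesis by (auto simp: eventually_sequentially)
qed simp

theorem corollary3:
  fixes P :: "nat \<Rightarrow> 'a measure"
    and \<epsilon> :: "nat \<Rightarrow> nat \<Rightarrow> 'a \<Rightarrow> real"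
    and x :: "nat \<Rightarrow> nat \<Rightarrow> nat \<Rightarrow> real"
    and M :: "nat \<Rightarrow> nat"
    and \<beta> :: "nat \<Rightarrow> real"
    and \<sigma> \<kappa> :: real
    and a :: "nat \<Rightarrow> real"
    and W :: "nat \<Rightarrow> nat \<Rightarrow> real"
    and M_hat :: "nat \<Rightarrow> 'a \<Rightarrow> nat set"
  defines "t \<equiv> true_model \<beta>"
  assumes prob: "\<And>n. prob_space (P n)"
    and sigma: "0 < \<sigma>"
    and eps_indep: "\<And>n. prob_space.indep_vars (P n) (\<lambda>_. borel) (\<epsilon> n) {1..n}"
    and eps_normal: "\<And>n l. l \<in> {1..n} \<Longrightarrow>
           distributed (P n) lborel (\<epsilon> n l) (normal_density 0 \<sigma>)"
    and M_mono: "mono M"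
    and t_finite: "finite t"
    and a_nonneg: "\<And>n. 0 \<le> a n"
    and a_lim: "filterlim a at_top sequentially"
    and M_hat_measurable: "\<And>n. M n < n \<Longrightarrow> M_hat n \<in> P n \<rightarrow>\<^sub>M count_space UNIV"
    and M_hat_choice: "\<And>n \<omega>. M n < n \<Longrightarrow> \<omega> \<in> space (P n) \<Longrightarrow>
           is_mpvc_choice (Pow {1..M n}) n (M n) (a n) (x n)
             (response (x n) (M n) \<beta> (\<lambda>l. \<epsilon> n l \<omega>)) (M_hat n \<omega>)"
    and A1_lim: "\<And>i k. i \<in> t \<Longrightarrow> k \<in> t \<Longrightarrow>
           (\<lambda>n. (1 / real n) * (\<Sum>l=1..n. x n l i * x n l k)) \<longlonglongrightarrow> W i k"
    and A1_pos_def: "pos_def_on t W"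
    and A2: "(\<lambda>n. real (M n) / a n) \<longlonglongrightarrow> 0"
    and A3: "ereal (real (if t = {} then 0 else Max t)) \<le> lim (\<lambda>n. ereal (real (M n)))"
    and A4_pos: "0 < \<kappa>"
    and A4: "\<And>n. 1 \<le> n \<Longrightarrow> 1 \<le> M n \<Longrightarrow> \<kappa> < min_eigenvalue (normalized_gram n (M n) (x n))"
    and A5: "(\<lambda>n. a n / real n) \<longlonglongrightarrow> 0"
  shows "(\<lambda>n. measure (P n) {\<omega> \<in> space (P n). M_hat n \<omega> = t}) \<longlonglongrightarrow> 1"
proof -
  obtain v where v: "0 < v" "\<And>i. i \<in> t \<Longrightarrow> v \<le> (\<beta> i)\<^sup>2"
  proof (cases "t = {}")
    case True
    then show ?thesis using that[of 1] by simp
  next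
    case False
    have "Min ((\<lambda>i. (\<beta> i)\<^sup>2) ` t) \<in> (\<lambda>i. (\<beta> i)\<^sup>2) ` t"
      using False t_finite by (intro Min_in) auto
    then have "0 < Min ((\<lambda>i. (\<beta> i)\<^sup>2) ` t)" by (auto simp: t_def true_model_def)
    then show ?thesis using t_finite by (intro that[of "Min ((\<lambda>i. (\<beta> i)\<^sup>2) ` t)"]) auto
  qed
  \<comment> \<open>\<open>n d\<close> bounds the excess residual sum of a model that misses a regressor, after half of it
    has been given up to the noise; \<open>c\<close> is the resulting bound on its \<open>R_coeff\<close>.\<close>
  define d where "d = \<kappa> * v / 4"
  define c where "c = d / (d + 2 * \<sigma>\<^sup>2)"
  define \<gamma> where "\<gamma> = ln ((1 - c / 2) / (1 - c))"
  have dpos: "0 < d" using A4_pos v by (simp add: d_def)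
  have "0 < d + 2 * \<sigma>\<^sup>2" using dpos sigma by (intro add_pos_pos) auto
  then have c01: "0 < c" "c < 1" using dpos sigma by (auto simp: c_def)
  have \<gamma>_pos: "0 < \<gamma>" using c01 by (auto simp: \<gamma>_def field_simps)
  have inv: "(\<lambda>n. 1 / real n) \<longlonglongrightarrow> 0" by (rule lim_1_over_n)
  have Mn: "(\<lambda>n. real (M n) / real n) \<longlonglongrightarrow> 0"
  proof (rule Lim_transform_eventually)
    show "(\<lambda>n. (real (M n) / a n) * (a n / real n)) \<longlonglongrightarrow> 0"
      using tendsto_mult[OF A2 A5] by simp
    show "\<forall>\<^sub>F n in sequentially. (real (M n) / a n) * (a n / real n) = real (M n) / real n"
      using filterlim_at_top_dense[THEN iffD1, OF a_lim, rule_format, of 0]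
      by eventually_elim simp
  qed
  \<comment> \<open>After division by \<open>n\<close> only the term \<open>- \<gamma> / 2\<close> survives in the limit.\<close>
  have ev_tail: "\<forall>\<^sub>F n in sequentially. ln (2 / c) + real (M n) / 2 * ln (4 / c)
          - ((real n - real (M n)) / 2 - 1) * \<gamma> < - (real (card t + 1) * a n)"
  proof -
    have "(\<lambda>n. ln (2 / c) * (1 / real n) + ln (4 / c) / 2 * (real (M n) / real n) + \<gamma> / 2 * (real (M n) / real n)
        + \<gamma> * (1 / real n) + real (card t + 1) * (a n / real n)) \<longlonglongrightarrow>
        ln (2 / c) * 0 + ln (4 / c) / 2 * 0 + \<gamma> / 2 * 0 + \<gamma> * 0 + real (card t + 1) * 0"
      by (intro tendsto_intros inv Mn A5)
    then have "\<forall>\<^sub>F n in sequentially. ln (2 / c) * (1 / real n) + ln (4 / c) / 2 * (real (M n) / real n)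
        + \<gamma> / 2 * (real (M n) / real n) + \<gamma> * (1 / real n) + real (card t + 1) * (a n / real n) < \<gamma> / 2"
      using \<gamma>_pos by (intro order_tendstoD(2)) auto
    then show ?thesis
      using eventually_gt_at_top[of 0]
    proof eventually_elim
      case (elim n)
      then have "real n * (ln (2 / c) * (1 / real n) + ln (4 / c) / 2 * (real (M n) / real n)
        + \<gamma> / 2 * (real (M n) / real n) + \<gamma> * (1 / real n) + real (card t + 1) * (a n / real n)) < real n * (\<gamma> / 2)"
        by (intro mult_strict_left_mono) auto
      also have "real n * (ln (2 / c) * (1 / real n) + ln (4 / c) / 2 * (real (M n) / real n)
        + \<gamma> / 2 * (real (M n) / real n) + \<gamma> * (1 / real n) + real (card t + 1) * (a n / real n))
        = ln (2 / c) + ln (4 / c) / 2 * real (M n) + \<gamma> / 2 * real (M n) + \<gamma> + real (card t + 1) * a n"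
        using elim(2) by (simp add: distrib_left del: of_nat_add)
      finally show ?case by (simp add: algebra_simps diff_divide_distrib)
    qed
  qed
  have ev_sub: "\<forall>\<^sub>F n in sequentially. t \<subseteq> {1..M n}"
    using M_mono t_finite _ A3 by (rule eventually_subset_of_lim_ge_Max) (simp add: t_def true_model_def)
  have ev_a32: "\<forall>\<^sub>F n in sequentially. 32 \<le> a n"
    using a_lim by (simp add: filterlim_at_top)
  have ev_Ma: "\<forall>\<^sub>F n in sequentially. real (M n) / a n < 1 / 16"
    using A2 by (rule order_tendstoD) simp
  have ev_an: "\<forall>\<^sub>F n in sequentially. a n / real n < min 2 (32 * d / \<sigma>\<^sup>2)"
    using A5 by (rule order_tendstoD) (use dpos sigma in simp)
  have ev_Mn: "\<forall>\<^sub>F n in sequentially. real (M n) / real n < 1 / 2"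
    using Mn by (rule order_tendstoD) simp
  have lower: "\<forall>\<^sub>F n in sequentially.
      1 - (32 * (real (M n) / a n) + 8 * (1 / real n)) \<le> measure (P n) {\<omega> \<in> space (P n). M_hat n \<omega> = t}"
    using ev_tail ev_sub ev_a32 ev_Ma ev_an ev_Mn eventually_ge_at_top[of 4]
  proof eventually_elim
    case (elim n)
    have npos: "0 < real n" using elim by simp
    have M_small: "M n + 2 \<le> n" using elim(6,7) npos by (simp add: field_simps)
    interpret gaussian_noise "P n" n \<sigma> "\<epsilon> n"
      using prob sigma eps_indep eps_normal by (intro gaussian_noise.intro gaussian_noise_axioms.intro) auto
    obtain q where q: "projection_basis n (x n) {1..M n} q"
      using orthogonal_projection_exists[of "{1..M n}"] by auto
    let ?good = "{\<omega> \<in> space (P n). (\<Sum>k\<in>{1..M n}. (dot n (q k) (\<lambda>l. \<epsilon> n l \<omega>))\<^sup>2) < \<sigma>\<^sup>2 * a n / 32 \<and>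
         \<bar>dot n (\<lambda>l. \<epsilon> n l \<omega>) (\<lambda>l. \<epsilon> n l \<omega>) - real n * \<sigma>\<^sup>2\<bar> < real n * \<sigma>\<^sup>2 / 2}"
    have "1 - (32 * (real (M n) / a n) + 8 * (1 / real n))
        = 1 - (\<sigma>\<^sup>2 * real (card {1..M n}) / (\<sigma>\<^sup>2 * a n / 32) + 8 / real n)"
      using sigma elim(3) by (simp add: field_simps)
    also have "\<dots> \<le> measure (P n) ?good"
      using q sigma elim(3,7) by (intro prob_good_event) (auto simp: projection_basis_def)
    also have "\<dots> \<le> measure (P n) {\<omega> \<in> space (P n). M_hat n \<omega> = t}"
    proof (rule finite_measure_mono)
      show "{\<omega> \<in> space (P n). M_hat n \<omega> = t} \<in> events"
        using measurable_sets[OF M_hat_measurable, of n "{t}"] M_small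
        by (simp add: vimage_def Int_def conj_commute)
      show "?good \<subseteq> {\<omega> \<in> space (P n). M_hat n \<omega> = t}"
      proof
        fix \<omega> assume good: "\<omega> \<in> ?good"
        have "M_hat n \<omega> = true_model \<beta>"
        proof (rule mpvc_selects_true_model[OF q, where e = "\<lambda>l. \<epsilon> n l \<omega>" and \<sigma> = \<sigma> and \<kappa> = \<kappa> and v = v and d = d and c = c and a = "a n"])
          show "16 * real (M n) \<le> a n" using elim(3,4) by (simp add: field_simps)
          show "a n \<le> 2 * real n" "\<sigma>\<^sup>2 * a n / 32 \<le> real n * d"
            using elim(5) npos sigma by (simp_all add: field_simps)
          show "1 \<le> M n \<Longrightarrow> \<kappa> < min_eigenvalue (normalized_gram n (M n) (x n))"
            using elim(7) by (intro A4) auto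
          show "is_mpvc_choice (Pow {1..M n}) n (M n) (a n) (x n)
             (response (x n) (M n) \<beta> (\<lambda>l. \<epsilon> n l \<omega>)) (M_hat n \<omega>)"
            using good M_small by (intro M_hat_choice) auto
        qed (use good M_small elim v sigma A4_pos in \<open>auto simp: t_def d_def c_def \<gamma>_def\<close>)
        then show "\<omega> \<in> {\<omega> \<in> space (P n). M_hat n \<omega> = t}" using good by (simp add: t_def)
      qed
    qed
    finally show ?case .
  qed
  show ?thesis
  proof (rule tendsto_sandwich[OF lower])
    show "(\<lambda>n. 1 - (32 * (real (M n) / a n) + 8 * (1 / real n))) \<longlonglongrightarrow> 1"
      using tendsto_diff[OF tendsto_const tendsto_add[OF tendsto_mult_left[OF A2, of 32] tendsto_mult_left[OF inv, of 8]], of 1]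
      by simp
    show "\<forall>\<^sub>F n in sequentially. measure (P n) {\<omega> \<in> space (P n). M_hat n \<omega> = t} \<le> 1"
      using prob by (intro always_eventually allI prob_space.prob_le_1)
  qed simp
qed

end
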